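(* Let $c_0<1$, $0>\alpha>c_0-1$, $f\in\mathcal{M}^{-1}(L_c)$, $h\in L_1(\mathbb{R}_+;2x^{\alpha/2}K_\alpha(2\sqrt{x})\,dx)$ and $g\in L_1(\mathbb{R}_+;x^{\alpha-1}dx)$. Suppose that $(Fh)(z)$ has no zeros in the strip $\operatorname{Re} z\in(\alpha,0)$ and that the quotient $(\mathcal{M}g)(z)/(Fh)(z)$ satisfies in this strip the condition $$\frac{(\mathcal{M}g)(\gamma+i\tau)}{(Fh)(\gamma+i\tau)}\in L_1\left(|\tau|>1;\ |\tau|^{\gamma+1/2}e^{\pi|\tau|/2}\,d\tau\right),\qquad \gamma\in(\alpha,0).$$ If $f$ is a solution of the integral equation $$\int_0^\infty k_h(x,y)f(y)\,dy=g(x),\quad x>0,\qquad k_h(x,y)=2\int_0^\infty K_0\left(2\sqrt{\frac{(x+y)(x+u)}{x}}\right)h(u)\,du,$$ then it has the form $$f(x)=\frac{1}{2\pi i}\int_{\gamma-i\infty}^{\gamma+i\infty}I_{-(1+z)}(2\sqrt{x})\,x^{-(1+z)/2}\,\frac{(\mathcal{M}g)(z)}{(Fh)(z)}\,dz,\qquad x>0,\ \gamma\in(\alpha,0).$$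
   Context: $\mathbb{R}_+=(0,\infty)$. $K_z$ and $I_\nu$ are the modified Bessel functions of the second and first kind, respectively, of complex order. The transformation $F$ is $(Fh)(z)=2\int_0^\infty x^{z/2}K_z(2\sqrt{x})h(x)\,dx$ and the Mellin transform is $(\mathcal{M}g)(z)=\int_0^\infty g(x)x^{z-1}\,dx$. For $c_0\in\mathbb{R}$ let $c=\{s\in\mathbb{C}:\operatorname{Re} s=c_0\}$. $\mathcal{M}^{-1}(L_c)$ is the space of functions $f(x)$, $x\in\mathbb{R}_+$, representable in the form $f(x)=\frac{1}{2\pi i}\int_c f^*(s)x^{-s}\,ds$ with $f^*\in L_1(c)$. The weighted space $L_1(\mathbb{R}_+;w(x)dx)$ has norm $\int_0^\infty|f(x)|w(x)\,dx$. In the equation, $h,g$ are given functions and $f$ is to be determined. *)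

theory Defs
  imports "HOL-Analysis.Analysis"
begin

text \<open>
  Modified Bessel functions of complex order \<open>\<nu>\<close> and positive real argument \<open>x\<close>.  The power series
  for the first kind uses \<^const>\<open>rGamma\<close> (the entire function \<open>1 / \<Gamma>\<close>), so it is meaningful for all
  \<open>\<nu>\<close>, negative integers included.  The second kind (Macdonald function) is given by its classical
  integral, absolutely convergent for all complex \<open>\<nu>\<close> and all \<open>x > 0\<close>.
\<close>

definition bessel_I :: "complex \<Rightarrow> real \<Rightarrow> complex" where
  "bessel_I \<nu> x =
     (\<Sum>k. of_real (x / 2) powr (\<nu> + 2 * of_nat k) * rGamma (\<nu> + of_nat k + 1) / fact k)"

definition bessel_K :: "complex \<Rightarrow> real \<Rightarrow> complex" where
  "bessel_K \<nu> x = (LBINT u:{0<..}. of_real (exp (- x * cosh u)) * cosh (\<nu> * of_real u))"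

definition F_transform :: "(real \<Rightarrow> complex) \<Rightarrow> complex \<Rightarrow> complex" where
  "F_transform h z =
     2 * (LBINT x:{0<..}. of_real x powr (z / 2) * bessel_K z (2 * sqrt x) * h x)"

definition mellin :: "(real \<Rightarrow> complex) \<Rightarrow> complex \<Rightarrow> complex" where
  "mellin g z = (LBINT x:{0<..}. g x * of_real x powr (z - 1))"

text \<open>
  Integral of \<open>\<phi>\<close> along the upward vertical line \<open>Re s = a\<close>; the factor \<open>\<i>\<close> comes from
  \<open>ds = \<i> dt\<close> for \<open>s = a + \<i> t\<close>.
\<close>

definition vline_integrable :: "real \<Rightarrow> (complex \<Rightarrow> complex) \<Rightarrow> bool" where
  "vline_integrable a \<phi> \<longleftrightarrow> integrable lborel (\<lambda>t. \<phi> (Complex a t))"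

definition vline_integral :: "real \<Rightarrow> (complex \<Rightarrow> complex) \<Rightarrow> complex" where
  "vline_integral a \<phi> = \<i> * (LBINT t. \<phi> (Complex a t))"

definition inv_mellin_space :: "real \<Rightarrow> (real \<Rightarrow> complex) set" where
  "inv_mellin_space a =
     {f. \<exists>\<phi>. vline_integrable a \<phi> \<and>
           (\<forall>x>0. f x = 1 / (2 * of_real pi * \<i>) *
                          vline_integral a (\<lambda>s. \<phi> s * of_real x powr (- s)))}"

definition weighted_L1 :: "real set \<Rightarrow> (real \<Rightarrow> real) \<Rightarrow> (real \<Rightarrow> complex) set" where
  "weighted_L1 A w =
     {f. set_borel_measurable lborel A f \<and> set_integrable lborel A (\<lambda>x. norm (f x) * w x)}"

definition conv_kernel :: "(real \<Rightarrow> complex) \<Rightarrow> real \<Rightarrow> real \<Rightarrow> complex" where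
  "conv_kernel h x y =
     2 * (LBINT u:{0<..}. bessel_K 0 (2 * sqrt ((x + y) * (x + u) / x)) * h u)"

end

theory Submission
  imports Defs "HOL-Probability.Probability" "HOL-Real_Asymp.Real_Asymp"
begin

text \<open>
  Put \<open>W(z, x) = 2 x\<^bsup>z/2\<^esup> K\<^sub>z(2\<surd>x)\<close>.  The exponential form of the Macdonald integral,
  \<open>W(z, x) = \<integral> exp (z r - e\<^bsup>r\<^esup> - x e\<^bsup>-r\<^esup>) dr\<close> over the real line (\<open>Macdonald_W_eq_bessel_K\<close>),
  is the source of both steps below.

  \<^bold>\<open>Convolution.\<close>  In the same form the kernel \<open>2 K\<^sub>0(2\<surd>((x+y)(x+u)/x))\<close> is an integral over a parameter
  \<open>a\<close> in which, after \<open>x = e\<^bsup>a+b\<^esup>\<close>, the variables separate.  Its Mellin transform in \<open>x\<close> is therefore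
  \<open>W(z, u) W(z, y)\<close> (\<open>Macdonald_kernel_Mellin\<close>), and integrating against \<open>h(u) f(y)\<close> turns the integral
  equation into \<open>\<M>g = Fh \<cdot> Ff\<close> (\<open>Mellin_Macdonald_convolution\<close>).  Hence the quotient \<open>\<M>g / Fh\<close> is \<open>Ff\<close>,
  and the problem is to invert \<open>F\<close>.

  \<^bold>\<open>Inversion of\<close> \<open>F\<close>.  Integrating first in \<open>y\<close> shows that \<open>Ff(\<gamma> + i\<tau>)\<close> is the Fourier transform of
  \<open>r \<mapsto> exp (\<gamma> r - e\<^bsup>r\<^esup>) L(e\<^bsup>-r\<^esup>)\<close>, with \<open>L\<close> the Laplace transform of \<open>f\<close>.  Functions in
  \<open>\<M>\<^sup>-\<^sup>1(L\<^sub>c)\<close> are continuous and \<open>O(x\<^bsup>-c\<^sub>0\<^esup>)\<close>, which makes this profile continuous, bounded and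
  integrable as soon as \<open>\<gamma> > c\<^sub>0 - 1\<close>.  Fourier inversion then gives
  \<open>L(p) = (1/2\<pi>i) \<integral> e\<^bsup>1/p\<^esup> p\<^sup>z Ff(z) dz\<close> (\<open>Laplace_inversion\<close>).

  \<^bold>\<open>Removing the Laplace transform.\<close>  For \<open>Re z < 0\<close> the function \<open>e\<^bsup>1/p\<^esup> p\<^sup>z\<close> is itself the Laplace transform
  of \<open>S\<^sub>z(x) = x\<^bsup>-(1+z)/2\<^esup> I\<^bsub>-(1+z)\<^esub>(2\<surd>x)\<close>: its expansion into powers \<open>p\<^bsup>z-k\<^esup>\<close> is the termwise transform of
  the Bessel series (\<open>Bessel_kernel_Laplace\<close>).  So \<open>f\<close> and \<open>(1/2\<pi>i) \<integral> S\<^sub>z(x) Ff(z) dz\<close> are continuous functions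
  with the same Laplace transform, hence equal (\<open>Laplace_uniqueness\<close>).

  The weight in the hypothesis on the quotient is what makes the last integral and the exchange of
  integrations legitimate: \<open>|S\<^sub>z(x)|\<close> is at most a function of \<open>x\<close> times \<open>|1/\<Gamma>(-z)|\<close>, and
  \<open>|1/\<Gamma>(-\<gamma> - i\<tau>)|\<close> is at most of order \<open>|\<tau>|\<^bsup>\<gamma>+1/2\<^esup> e\<^bsup>\<pi>|\<tau>|/2\<^esup>\<close> (\<open>norm_rGamma_vertical_le\<close>).
\<close>

section \<open>The substitution of the exponential and Gamma integrals\<close>

lemma of_real_powr_eq_exp:
  assumes "x > 0"
  shows "complex_of_real x powr w = exp (w * of_real (ln x))"
  using assms by (simp add: powr_def Ln_of_real)

lemma of_real_powr_real_eq_exp: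
  assumes "x > 0"
  shows "complex_of_real (x powr b) = exp (of_real (b * ln x))"
  using assms by (simp add: powr_def flip: exp_of_real)

lemma borel_measurable_of_real_powr [measurable (raw)]:
  fixes u :: "'a \<Rightarrow> real" and w :: "'a \<Rightarrow> complex"
  assumes [measurable]: "u \<in> borel_measurable M" "w \<in> borel_measurable M"
  shows "(\<lambda>x. complex_of_real (u x) powr w x) \<in> borel_measurable M"
proof -
  have "complex_of_real (u x) powr w x = (if u x = 0 then 0
      else exp (w x * (of_real (ln \<bar>u x\<bar>) + (if u x < 0 then \<i> * of_real pi else 0))))" for x
    using Ln_of_real[of "u x"] Ln_Reals_eq[of "u x"] Ln_minus[of "of_real \<bar>u x\<bar>"]
    by (auto simp: powr_def Ln_of_real not_less)
  then show ?thesis by simp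
qed

lemma integral_exp_substitution:
  fixes k :: "real \<Rightarrow> 'a::euclidean_space"
  assumes k: "set_borel_measurable borel {0<..} k"
  shows "integrable lborel (\<lambda>r. exp r *\<^sub>R k (exp r)) \<longleftrightarrow> set_integrable lborel {0<..} k"
    and "(LBINT r. exp r *\<^sub>R k (exp r)) = (LBINT x:{0<..}. k x)"
proof -
  have [measurable]: "(\<lambda>x. indicator {0<..} x *\<^sub>R k x) \<in> borel_measurable borel"
    using k by (simp add: set_borel_measurable_def)
  have "(\<lambda>r. exp r *\<^sub>R (indicator {0<..} (exp r) *\<^sub>R k (exp r))) \<in> borel_measurable borel"
    by measurable
  then have m [measurable]: "(\<lambda>r. exp r *\<^sub>R k (exp r)) \<in> borel_measurable borel"
    by simp
  have range: "range exp = {0::real<..}"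
    by (auto simp: image_def) (metis exp_ln)
  have abs1: "set_integrable lborel {0<..} k \<longleftrightarrow> k absolutely_integrable_on {0<..}"
    unfolding set_integrable_def
    by (rule integrable_completion[symmetric]) simp
  have abs2: "integrable lborel (\<lambda>r. exp r *\<^sub>R k (exp r)) \<longleftrightarrow>
      (\<lambda>r. exp r *\<^sub>R k (exp r)) absolutely_integrable_on UNIV"
    unfolding set_integrable_def by (simp add: integrable_completion)
  have cov: "k absolutely_integrable_on exp ` UNIV \<longleftrightarrow>
     (\<lambda>r. \<bar>exp r\<bar> *\<^sub>R k (exp r)) absolutely_integrable_on UNIV"
    by (rule absolutely_integrable_change_of_variables_real) (auto intro!: derivative_eq_intros simp: inj_def)
  show iff: "integrable lborel (\<lambda>r. exp r *\<^sub>R k (exp r)) \<longleftrightarrow> set_integrable lborel {0<..} k"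
    using cov unfolding abs1 abs2 range by simp
  show "(LBINT r. exp r *\<^sub>R k (exp r)) = (LBINT x:{0<..}. k x)"
  proof (cases "set_integrable lborel {0<..} k")
    case True
    then have i: "integrable lborel (\<lambda>r. exp r *\<^sub>R k (exp r))" using iff by simp
    have "((\<lambda>r. \<bar>exp r\<bar> *\<^sub>R k (exp r)) absolutely_integrable_on UNIV \<and>
        integral UNIV (\<lambda>r. \<bar>exp r\<bar> *\<^sub>R k (exp r)) = integral {0<..} k) \<longleftrightarrow>
      (k absolutely_integrable_on exp ` UNIV \<and> integral (exp ` UNIV) k = integral {0<..} k)"
      by (rule has_absolute_integral_change_of_variables_real) (auto intro!: derivative_eq_intros simp: inj_def)
    then have "integral UNIV (\<lambda>r. exp r *\<^sub>R k (exp r)) = integral {0<..} k"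
      using True abs1 by (simp add: range)
    then show ?thesis
      using set_borel_integral_eq_integral(2)[OF True] integral_lborel[OF i] by simp
  next
    case False
    then have "\<not> integrable lborel (\<lambda>r. exp r *\<^sub>R k (exp r))" using iff by simp
    then show ?thesis using False
      by (simp add: set_integrable_def set_lebesgue_integral_def not_integrable_integral_eq)
  qed
qed

lemma lborel_integral_shift:
  fixes k :: "real \<Rightarrow> 'a::euclidean_space"
  shows "(LBINT r. k (r + c)) = (LBINT r. k r)"
    and "integrable lborel (\<lambda>r. k (r + c)) \<longleftrightarrow> integrable lborel k"
  using lborel_integral_real_affine[of 1 k c] lborel_integrable_real_affine_iff[of 1 k c]
  by (simp_all add: add.commute)

text \<open>
  In the variable \<open>ln x\<close> the scaling by \<open>p\<close> is a translation, so that the case \<open>p = 1\<close> suffices, for complex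
  exponents \<open>b\<close> too.
\<close>

lemma Gamma_integral_exp:
  assumes "Re b > 0" "p > 0"
  shows "integrable lborel (\<lambda>r. exp (b * of_real r - of_real (p * exp r)))"
    and "(LBINT r. exp (b * of_real r - of_real (p * exp r))) = Gamma b * of_real p powr (- b)"
proof -
  let ?k = "\<lambda>x. complex_of_real x powr (b - 1) / of_real (exp x)"
  let ?E = "\<lambda>r. exp (b * of_real r - of_real (exp r)) :: complex"
  have si: "set_integrable lborel {0<..} ?k"
    using absolutely_integrable_Gamma_integral'[OF assms(1)] unfolding set_integrable_def
    by (subst (asm) integrable_completion) simp_all
  have m: "set_borel_measurable borel {0<..} ?k"
    by (simp add: set_borel_measurable_def)
  have E: "exp r *\<^sub>R ?k (exp r) = ?E r" for r
    by (simp add: powr_def exp_diff exp_add exp_of_real[symmetric] Ln_of_real scaleR_conv_of_real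
        algebra_simps)
  have int1: "integrable lborel ?E"
    using integral_exp_substitution(1)[OF m] si unfolding E by simp
  have "(LBINT r. ?E r) = (LBINT x:{0<..}. ?k x)"
    using integral_exp_substitution(2)[OF m] unfolding E by simp
  also have "\<dots> = Gamma b"
    using set_borel_integral_eq_integral(2)[OF si]
      integral_unique[OF Gamma_integral_complex'[OF assms(1)]] by simp
  finally have eq1: "(LBINT r. ?E r) = Gamma b" .
  have shift: "exp (b * of_real r - of_real (p * exp r))
      = of_real p powr (- b) * ?E (r + ln p)" for r
    using assms(2)
    by (simp add: powr_def exp_add exp_diff Ln_of_real exp_minus field_simps)
  show "integrable lborel (\<lambda>r. exp (b * of_real r - of_real (p * exp r)))"
    unfolding shift using lborel_integral_shift(2)[of ?E "ln p"] int1 by simp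
  show "(LBINT r. exp (b * of_real r - of_real (p * exp r))) = Gamma b * of_real p powr (- b)"
    unfolding shift using lborel_integral_shift(1)[of ?E "ln p"] eq1 by simp
qed

lemma Gamma_integral_Laplace:
  assumes "Re b > 0" "p > 0"
  shows "set_integrable lborel {0<..} (\<lambda>x. complex_of_real x powr (b - 1) * of_real (exp (- p * x)))"
    and "(LBINT x:{0<..}. of_real x powr (b - 1) * of_real (exp (- p * x))) 
      = Gamma b * of_real p powr (- b)"
proof -
  let ?k = "\<lambda>x. complex_of_real x powr (b - 1) * of_real (exp (- p * x))"
  have m: "set_borel_measurable borel {0<..} ?k"
    by (simp add: set_borel_measurable_def)
  have E: "exp r *\<^sub>R ?k (exp r) = exp (b * of_real r - of_real (p * exp r))" for r
    by (simp add: powr_def exp_diff exp_add exp_of_real[symmetric] Ln_of_real scaleR_conv_of_real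
        algebra_simps exp_minus field_simps)
  show "set_integrable lborel {0<..} ?k"
    using integral_exp_substitution(1)[OF m] Gamma_integral_exp(1)[OF assms] unfolding E by simp
  show "(LBINT x:{0<..}. ?k x) = Gamma b * of_real p powr (- b)"
    using integral_exp_substitution(2)[OF m] Gamma_integral_exp(2)[OF assms] unfolding E by simp
qed

section \<open>The reciprocal Gamma function on vertical lines\<close>

text \<open>
  On this line \<open>1 - z\<close> is the conjugate of \<open>z\<close>, and the reflection formula becomes an exact value of the
  modulus.  Every other vertical line is compared with it below.
\<close>

lemma norm_rGamma_half_line:
  "norm (rGamma (Complex (1/2) t)) \<le> exp (pi * \<bar>t\<bar> / 2) / sqrt pi"
proof -
  define z where "z = Complex (1/2) t"
  have "1 - z = cnj z" by (simp add: z_def complex_eq_iff)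
  then have "rGamma (1 - z) = cnj (rGamma z)"
    by (simp add: cnj_rGamma)
  then have "sin (of_real pi * z) / of_real pi = rGamma z * cnj (rGamma z)"
    using rGamma_reflection_complex[of z] by simp
  then have "(norm (rGamma z))\<^sup>2 = norm (sin (of_real pi * z)) / pi"
    by (metis complex_mod_mult_cnj norm_divide norm_of_real abs_of_pos pi_gt_zero)
  moreover have "norm (sin (of_real pi * z)) \<le> exp (pi * \<bar>t\<bar>)"
  proof -
    have "norm (sin (of_real pi * z)) = norm (exp (\<i> * (of_real pi * z)) - exp (- (\<i> * (of_real pi * z)))) / 2"
      by (simp add: sin_exp_eq norm_divide norm_mult)
    also have "\<dots> \<le> (norm (exp (\<i> * (of_real pi * z))) + norm (exp (- (\<i> * (of_real pi * z))))) / 2"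
      by (intro divide_right_mono norm_triangle_ineq4) auto
    also have "\<dots> = (exp (- pi * t) + exp (pi * t)) / 2"
      by (simp add: norm_exp_eq_Re z_def)
    also have "\<dots> \<le> (exp (pi * \<bar>t\<bar>) + exp (pi * \<bar>t\<bar>)) / 2"
      by (intro divide_right_mono add_mono) (auto simp: abs_if)
    finally show ?thesis by simp
  qed
  ultimately have "(norm (rGamma z))\<^sup>2 \<le> exp (pi * \<bar>t\<bar>) / pi"
    by (simp add: divide_right_mono)
  also have "\<dots> = (exp (pi * \<bar>t\<bar> / 2) / sqrt pi)\<^sup>2"
    by (simp add: power_divide power2_eq_square[of "exp _"] flip: exp_add)
  finally show ?thesis unfolding z_def[symmetric]
    by (rule power2_le_imp_le) simp
qed

text \<open>
  The factors of Euler's product for \<open>1/\<Gamma>\<close> on the lines \<open>Re z = a\<close> and \<open>Re z = 1/2\<close> are compared through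
  the function \<open>N(u) = ln |u + i\<tau>|\<close>.  Its derivative is \<open>Re (1 / (u + i\<tau>))\<close>, which varies by at most
  \<open>O(1/(k\<^sup>2 + 1))\<close> near \<open>u = k\<close>, uniformly in \<open>|\<tau>| \<ge> 1\<close>.  So the logarithm of the quotient of two
  corresponding factors agrees, up to a summable error, with a term whose sum over \<open>k\<close> telescopes.
\<close>

lemma log_modulus_increments:
  fixes a \<tau> :: real and k :: nat
  defines "N \<equiv> \<lambda>u. ln (cmod (Complex u \<tau>))"
  assumes a: "a > 0" and \<tau>: "\<bar>\<tau>\<bar> \<ge> 1"
  shows "\<bar>N (a + real k) - N (1/2 + real k) - (a - 1/2) * (N (real k + 1) - N k)\<bar>
    \<le> \<bar>a - 1/2\<bar> * max a 1 / ((real k)\<^sup>2 + 1)"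
proof -
  define D where "D u = u / (u\<^sup>2 + \<tau>\<^sup>2)" for u
  have tau0: "\<tau>\<^sup>2 \<ge> 1" using \<tau> by (simp add: abs_le_square_iff[of 1, simplified])
  have pos: "u\<^sup>2 + \<tau>\<^sup>2 > 0" for u using tau0 by (smt (verit) zero_le_power2)
  have N: "N u = ln (u\<^sup>2 + \<tau>\<^sup>2) / 2" for u
    by (simp add: N_def cmod_def ln_sqrt pos)
  have der: "(N has_real_derivative D u) (at u)" for u
    unfolding N D_def using pos[of u] by (auto intro!: derivative_eq_intros simp: divide_simps)
  have mvt: "\<exists>\<xi>. min u v \<le> \<xi> \<and> \<xi> \<le> max u v \<and> N v - N u = (v - u) * D \<xi>" for u v
  proof (cases u v rule: linorder_cases)
    case less
    from MVT2[OF less, of N D] der obtain \<xi> where "u < \<xi>" "\<xi> < v" "N v - N u = (v - u) * D \<xi>"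
      by blast
    then show ?thesis using less by (intro exI[of _ \<xi>]) auto
  next
    case greater
    from MVT2[OF greater, of N D] der obtain \<xi> where "v < \<xi>" "\<xi> < u" "N u - N v = (u - v) * D \<xi>"
      by blast
    then show ?thesis using greater by (intro exI[of _ \<xi>]) (auto simp: algebra_simps)
  qed auto
  obtain \<xi> where \<xi>: "min (1/2 + k) (a + k) \<le> \<xi>" "\<xi> \<le> max (1/2 + k) (a + k)"
      "N (a + real k) - N (1/2 + real k) = (a - 1/2) * D \<xi>"
    using mvt[of "1/2 + k" "a + k"] by auto
  obtain \<eta> where \<eta>: "real k \<le> \<eta>" "\<eta> \<le> k + 1" "N (real k + 1) - N k = D \<eta>"
    using mvt[of "real k" "real k + 1"] by (auto simp: add.commute)
  have \<xi>k: "real k \<le> \<xi>" using \<xi>(1) a by linarith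
  have diff: "\<bar>\<xi> - \<eta>\<bar> \<le> max a 1" using \<xi>(1,2) \<eta>(1,2) a by linarith
  let ?P = "(\<xi>\<^sup>2 + \<tau>\<^sup>2) * (\<eta>\<^sup>2 + \<tau>\<^sup>2)"
  \<comment> \<open>\<open>D \<xi> - D \<eta>\<close> has the numerator factor \<open>\<tau>\<^sup>2 - \<xi>\<eta>\<close>; this and \<open>k\<^sup>2 + 1\<close> are both at most the square root
      of the denominator.\<close>
  have P1: "(\<tau>\<^sup>2 - \<xi> * \<eta>)\<^sup>2 \<le> ?P"
  proof -
    have "?P = (\<tau>\<^sup>2 - \<xi> * \<eta>)\<^sup>2 + \<tau>\<^sup>2 * (\<xi> + \<eta>)\<^sup>2"
      by (simp add: power2_eq_square algebra_simps)
    then show ?thesis by simp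
  qed
  have P2: "((real k)\<^sup>2 + 1)\<^sup>2 \<le> ?P"
    unfolding power2_eq_square[of "(real k)\<^sup>2 + 1"]
    using \<xi>k \<eta>(1) tau0 by (intro mult_mono add_mono power_mono) auto
  have "\<bar>\<tau>\<^sup>2 - \<xi> * \<eta>\<bar> * ((real k)\<^sup>2 + 1) \<le> ?P"
  proof -
    have "2 * (\<bar>\<tau>\<^sup>2 - \<xi> * \<eta>\<bar> * ((real k)\<^sup>2 + 1)) \<le> (\<tau>\<^sup>2 - \<xi> * \<eta>)\<^sup>2 + ((real k)\<^sup>2 + 1)\<^sup>2"
      using sum_squares_bound[of "\<bar>\<tau>\<^sup>2 - \<xi> * \<eta>\<bar>" "(real k)\<^sup>2 + 1"]
      by (simp only: power2_abs mult.assoc)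
    with P1 P2 show ?thesis by linarith
  qed
  moreover have Ppos: "?P > 0" using pos by (intro mult_pos_pos)
  moreover have "x / P \<le> 1 / K" if "x * K \<le> P" "P > 0" "K > 0" for x P K :: real
    using that by (simp add: field_simps)
  ultimately have le: "\<bar>\<tau>\<^sup>2 - \<xi> * \<eta>\<bar> / ?P \<le> 1 / ((real k)\<^sup>2 + 1)"
    by (simp add: add_nonneg_pos)
  have "D \<xi> - D \<eta> = (\<xi> * (\<eta>\<^sup>2 + \<tau>\<^sup>2) - \<eta> * (\<xi>\<^sup>2 + \<tau>\<^sup>2)) / ?P"
    unfolding D_def using pos[of \<xi>] pos[of \<eta>] by (intro diff_frac_eq) auto
  also have "\<xi> * (\<eta>\<^sup>2 + \<tau>\<^sup>2) - \<eta> * (\<xi>\<^sup>2 + \<tau>\<^sup>2) = (\<xi> - \<eta>) * (\<tau>\<^sup>2 - \<xi> * \<eta>)"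
    by (simp add: power2_eq_square algebra_simps)
  finally have "D \<xi> - D \<eta> = (\<xi> - \<eta>) * ((\<tau>\<^sup>2 - \<xi> * \<eta>) / ?P)"
    by simp
  then have "\<bar>D \<xi> - D \<eta>\<bar> = \<bar>\<xi> - \<eta>\<bar> * (\<bar>\<tau>\<^sup>2 - \<xi> * \<eta>\<bar> / ?P)"
    using Ppos by (simp add: abs_mult)
  also have "\<dots> \<le> max a 1 * (1 / ((real k)\<^sup>2 + 1))"
    using le diff by (intro mult_mono) auto
  finally have "\<bar>D \<xi> - D \<eta>\<bar> \<le> max a 1 / ((real k)\<^sup>2 + 1)" by simp
  then have "\<bar>a - 1/2\<bar> * \<bar>D \<xi> - D \<eta>\<bar> \<le> \<bar>a - 1/2\<bar> * (max a 1 / ((real k)\<^sup>2 + 1))"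
    by (intro mult_left_mono) auto
  moreover have "N (a + real k) - N (1/2 + real k) - (a - 1/2) * (N (real k + 1) - N k) = (a - 1/2) * (D \<xi> - D \<eta>)"
    by (simp only: \<xi>(3) \<eta>(3) right_diff_distrib)
  ultimately show ?thesis by (simp add: abs_mult)
qed

text \<open>
  This is the upper half of Stirling's estimate on a vertical line.  By the preceding comparison the
  quotient of the partial products of \<open>1/\<Gamma>\<close> at \<open>a + i\<tau>\<close> and \<open>1/2 + i\<tau>\<close> is at most a constant times
  \<open>(|n + 1 + i\<tau>| / |\<tau>|)\<^bsup>a-1/2\<^esup> n\<^bsup>1/2-a\<^esup>\<close>, which tends to \<open>|\<tau>|\<^bsup>1/2-a\<^esup>\<close>.
\<close>

lemma norm_rGamma_vertical_le:
  assumes a: "a > 0"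
  obtains C where "C > 0"
    "\<And>\<tau>. \<bar>\<tau>\<bar> \<ge> 1 \<Longrightarrow> norm (rGamma (Complex a \<tau>)) \<le> C * (\<bar>\<tau>\<bar> powr (1/2 - a) * exp (pi * \<bar>\<tau>\<bar> / 2))"
proof -
  define e where "e k = \<bar>a - 1/2\<bar> * max a 1 / ((real k)\<^sup>2 + 1)" for k :: nat
  have sume: "summable e"
  proof (rule summable_comparison_test)
    show "summable (\<lambda>k. \<bar>a - 1/2\<bar> * max a 1 * inverse (real k ^ 2))"
      by (intro summable_mult inverse_power_summable) auto
    show "\<exists>M. \<forall>k\<ge>M. norm (e k) \<le> \<bar>a - 1/2\<bar> * max a 1 * inverse (real k ^ 2)"
    proof (intro exI[of _ 1] allI impI)
      fix k :: nat assume "1 \<le> k"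
      then have "1 / ((real k)\<^sup>2 + 1) \<le> inverse (real k ^ 2)"
        unfolding inverse_eq_divide by (intro frac_le) auto
      then have "\<bar>a - 1/2\<bar> * max a 1 * (1 / ((real k)\<^sup>2 + 1)) \<le> \<bar>a - 1/2\<bar> * max a 1 * inverse (real k ^ 2)"
        by (rule mult_left_mono) simp
      then show "norm (e k) \<le> \<bar>a - 1/2\<bar> * max a 1 * inverse (real k ^ 2)"
        by (simp add: e_def abs_mult)
    qed
  qed
  define C where "C = exp (suminf e)"
  have main: "norm (rGamma (Complex a \<tau>)) \<le> C * (\<bar>\<tau>\<bar> powr (1/2 - a) * norm (rGamma (Complex (1/2) \<tau>)))"
    if \<tau>: "\<bar>\<tau>\<bar> \<ge> 1" for \<tau>
  proof -
    define N where "N u = ln (cmod (Complex u \<tau>))" for u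
    have nz: "cmod (Complex u \<tau>) > 0" for u
    proof -
      have "\<tau> \<noteq> 0" using \<tau> by linarith
      then have "Complex u \<tau> \<noteq> 0" by (simp add: complex_eq_iff)
      then show ?thesis by simp
    qed
    have poch: "norm (pochhammer (Complex b \<tau>) (n + 1)) = exp (\<Sum>k\<le>n. N (b + real k))" for b n
    proof -
      have "norm (pochhammer (Complex b \<tau>) (n + 1)) = (\<Prod>k<Suc n. cmod (Complex (b + k) \<tau>))"
        by (simp add: pochhammer_prod prod_norm[symmetric] atLeast0LessThan
            del: prod.lessThan_Suc)
           (intro prod.cong arg_cong[where f = cmod], auto simp: complex_eq_iff)
      also have "\<dots> = (\<Prod>k<Suc n. exp (N (b + real k)))"
        unfolding N_def by (simp only: exp_ln[OF nz])
      also have "\<dots> = exp (\<Sum>k<Suc n. N (b + real k))"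
        by (simp only: exp_sum finite_lessThan)
      finally show ?thesis by (simp only: lessThan_Suc_atMost)
    qed
    have rG: "norm (rGamma_series (Complex b \<tau>) n) = exp (\<Sum>k\<le>n. N (b + real k)) / (fact n * exp (b * ln n))" for b n
      unfolding rGamma_series_def norm_divide norm_mult poch by (simp add: norm_exp_eq_Re)
    have step: "norm (rGamma_series (Complex a \<tau>) n) \<le>
        C * (exp ((a - 1/2) * (N (real n + 1) - ln n)) * \<bar>\<tau>\<bar> powr (1/2 - a)) *
          norm (rGamma_series (Complex (1/2) \<tau>) n)" for n
    proof -
      have "(\<Sum>k\<le>n. N (a + real k)) - (\<Sum>k\<le>n. N (1/2 + real k)) - (a - 1/2) * (\<Sum>k\<le>n. N (real k + 1) - N k)
          = (\<Sum>k\<le>n. N (a + real k) - N (1/2 + real k) - (a - 1/2) * (N (real k + 1) - N k))"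
        by (subst sum_distrib_left) (simp only: sum_subtractf)
      also have "\<dots> \<le> (\<Sum>k\<le>n. e k)"
        unfolding e_def N_def
        by (intro sum_mono order_trans[OF abs_ge_self log_modulus_increments[OF a \<tau>]])
      also have "\<dots> \<le> suminf e"
        by (intro sum_le_suminf sume) (auto simp: e_def)
      finally have "(\<Sum>k\<le>n. N (a + real k)) \<le> suminf e + (\<Sum>k\<le>n. N (1/2 + real k)) +
          (a - 1/2) * (\<Sum>k\<le>n. N (real k + 1) - N k)" by simp
      also have "(\<Sum>k\<le>n. N (real k + 1) - N k) = N (real n + 1) - N 0"
        using sum_telescope[of "\<lambda>k. - N (real k)" n] by (simp add: add.commute)
      also have "N 0 = ln \<bar>\<tau>\<bar>" by (simp add: N_def cmod_def)
      finally have "exp (\<Sum>k\<le>n. N (a + real k)) \<le> exp (suminf e + (\<Sum>k\<le>n. N (1/2 + real k)) +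
          (a - 1/2) * (N (real n + 1) - ln \<bar>\<tau>\<bar>))" by simp
      then have "norm (rGamma_series (Complex a \<tau>) n) \<le> exp (suminf e + (\<Sum>k\<le>n. N (1/2 + real k)) +
          (a - 1/2) * (N (real n + 1) - ln \<bar>\<tau>\<bar>)) / (fact n * exp (a * ln n))"
        unfolding rG by (intro divide_right_mono) auto
      also have "\<dots> = C * (exp ((a - 1/2) * (N (real n + 1) - ln n)) * \<bar>\<tau>\<bar> powr (1/2 - a)) *
          norm (rGamma_series (Complex (1/2) \<tau>) n)"
      proof -
        have "suminf e + (\<Sum>k\<le>n. N (1/2 + real k)) + (a - 1/2) * (N (real n + 1) - ln \<bar>\<tau>\<bar>) - a * ln n
          = suminf e + ((a - 1/2) * (N (real n + 1) - ln n) + (1/2 - a) * ln \<bar>\<tau>\<bar>) +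
              ((\<Sum>k\<le>n. N (1/2 + real k)) - 1/2 * ln n)"
          by (simp add: algebra_simps)
        then have "exp (suminf e + (\<Sum>k\<le>n. N (1/2 + real k)) + (a - 1/2) * (N (real n + 1) - ln \<bar>\<tau>\<bar>) - a * ln n)
          = exp (suminf e) * (exp ((a - 1/2) * (N (real n + 1) - ln n)) * exp ((1/2 - a) * ln \<bar>\<tau>\<bar>)) *
              exp ((\<Sum>k\<le>n. N (1/2 + real k)) - 1/2 * ln n)"
          by (simp only: exp_add)
        moreover have "exp X / (F * exp Y) = exp (X - Y) / F" for X Y F :: real
          by (simp add: exp_diff)
        moreover have "\<bar>\<tau>\<bar> powr (1/2 - a) = exp ((1/2 - a) * ln \<bar>\<tau>\<bar>)"
          using \<tau> by (simp add: powr_def)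
        ultimately show ?thesis unfolding rG C_def by (simp only: times_divide_eq_right)
      qed
      finally show ?thesis .
    qed
    have lim0: "(\<lambda>n. N (real n + 1) - ln n) \<longlonglongrightarrow> 0"
    proof -
      have "(\<lambda>n. ln ((real n + 1)\<^sup>2 + \<tau>\<^sup>2) / 2 - ln (real n)) \<longlonglongrightarrow> 0"
        by real_asymp
      moreover have N2: "N u = ln (u\<^sup>2 + \<tau>\<^sup>2) / 2" for u
        using nz[of u] by (simp add: N_def cmod_def ln_sqrt)
      ultimately show ?thesis by (simp only: N2)
    qed
    have "(\<lambda>n. C * (exp ((a - 1/2) * (N (real n + 1) - ln n)) * \<bar>\<tau>\<bar> powr (1/2 - a)) *
          norm (rGamma_series (Complex (1/2) \<tau>) n)) \<longlonglongrightarrow>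
          C * (exp ((a - 1/2) * 0) * \<bar>\<tau>\<bar> powr (1/2 - a)) * norm (rGamma (Complex (1/2) \<tau>))"
      by (intro tendsto_intros lim0 rGamma_series_LIMSEQ)
    moreover have "(\<lambda>n. norm (rGamma_series (Complex a \<tau>) n)) \<longlonglongrightarrow> norm (rGamma (Complex a \<tau>))"
      by (intro tendsto_intros rGamma_series_LIMSEQ)
    ultimately have "norm (rGamma (Complex a \<tau>)) \<le> 
        C * (exp ((a - 1/2) * 0) * \<bar>\<tau>\<bar> powr (1/2 - a)) * norm (rGamma (Complex (1/2) \<tau>))"
      using step by (intro LIMSEQ_le) auto
    then show ?thesis by (simp add: mult_ac)
  qed
  show ?thesis
  proof (rule that[of "C / sqrt pi"])
    show "C / sqrt pi > 0" by (simp add: C_def)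
    fix \<tau> :: real assume \<tau>: "\<bar>\<tau>\<bar> \<ge> 1"
    have "C * (\<bar>\<tau>\<bar> powr (1/2 - a) * norm (rGamma (Complex (1/2) \<tau>))) \<le>
        C * (\<bar>\<tau>\<bar> powr (1/2 - a) * (exp (pi * \<bar>\<tau>\<bar> / 2) / sqrt pi))"
      by (intro mult_left_mono norm_rGamma_half_line) (auto simp: C_def)
    with main[OF \<tau>] show "norm (rGamma (Complex a \<tau>)) \<le> 
        C / sqrt pi * (\<bar>\<tau>\<bar> powr (1/2 - a) * exp (pi * \<bar>\<tau>\<bar> / 2))"
      by simp
  qed
qed

section \<open>Fourier inversion and uniqueness of the Laplace transform\<close>

lemma std_normal_Fourier:
  "(LBINT s. std_normal_density s *\<^sub>R iexp (t * s)) = of_real (exp (- t\<^sup>2 / 2))"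
proof -
  have "char std_normal_distribution t = of_real (exp (- t\<^sup>2 / 2))"
    by (simp add: char_std_normal_distribution)
  then show ?thesis
    unfolding char_def
    by (subst (asm) integral_density) auto
qed

text \<open>
  A Gaussian factor \<open>exp (-(\<epsilon>\<tau>)\<^sup>2/2)\<close> makes Fubini's theorem applicable and turns the inversion integral into
  the mean of \<open>u\<close> against a normal density of width \<open>\<epsilon>\<close> centred at \<open>x\<close>.  As \<open>\<epsilon> \<rightarrow> 0\<close> both sides converge by
  dominated convergence.
\<close>

theorem Fourier_inversion:
  fixes u :: "real \<Rightarrow> complex"
  assumes cont: "continuous_on UNIV u" and bnd: "\<And>x. norm (u x) \<le> B"
    and int: "integrable lborel u"
    and intF: "integrable lborel (\<lambda>\<tau>. LBINT r. u r * iexp (\<tau> * r))"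
  shows "u x = 1 / (2 * of_real pi) * (LBINT \<tau>. (LBINT r. u r * iexp (\<tau> * r)) * iexp (- (\<tau> * x)))"
proof -
  define U where "U \<tau> = (LBINT r. u r * iexp (\<tau> * r))" for \<tau>
  have [measurable]: "u \<in> borel_measurable borel" using cont by (rule borel_measurable_continuous_onI)
  have U: "integrable lborel U" using intF by (simp add: U_def[abs_def])
  have [measurable]: "U \<in> borel_measurable borel" using borel_measurable_integrable[OF U] by simp
  have gauss: "(LBINT \<tau>. of_real (exp (- (e * \<tau>)\<^sup>2 / 2)) * iexp (\<tau> * y)) =
      of_real (2 * pi / e * std_normal_density (y / e))" if e: "e > 0" for e y :: real
  proof -
    have "(LBINT \<tau>. of_real (exp (- (e * \<tau>)\<^sup>2 / 2)) * iexp (\<tau> * y)) =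
        (LBINT \<tau>. of_real (sqrt (2 * pi)) * (std_normal_density (0 + e * \<tau>) *\<^sub>R iexp (y / e * (0 + e * \<tau>))))"
      using e by (intro Bochner_Integration.integral_cong)
        (auto simp: std_normal_density_def scaleR_conv_of_real mult_ac)
    also have "\<dots> = of_real (sqrt (2 * pi)) * ((1 / e) *\<^sub>R (LBINT s. std_normal_density s *\<^sub>R iexp (y / e * s)))"
      unfolding integral_mult_right_zero
      using lborel_integral_real_affine[of e "\<lambda>s. std_normal_density s *\<^sub>R iexp (y / e * s)" 0] e
      by simp
    also have "\<dots> = of_real (2 * pi / e * std_normal_density (y / e))"
      unfolding std_normal_Fourier using e
      by (simp add: std_normal_density_def scaleR_conv_of_real divide_simps flip: of_real_mult)
    finally show ?thesis .
  qed
  have gint: "integrable lborel (\<lambda>\<tau>. exp (- (e * \<tau>)\<^sup>2 / 2))" if e: "e > 0" for e :: real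
  proof -
    have "integrable lborel (\<lambda>\<tau>. sqrt (2 * pi) * std_normal_density (0 + e * \<tau>))"
      using e by (intro integrable_mult_right lborel_integrable_real_affine integrable_normal_density) auto
    then show ?thesis by (simp add: std_normal_density_def)
  qed
  have J: "(LBINT \<tau>. of_real (exp (- (e * \<tau>)\<^sup>2 / 2)) * (U \<tau> * iexp (- (\<tau> * x)))) =
      2 * of_real pi * (LBINT s. std_normal_density s *\<^sub>R u (x + e * s))" if e: "e > 0" for e :: real
  proof -
    define k where "k \<tau> r = of_real (exp (- (e * \<tau>)\<^sup>2 / 2)) * (u r * iexp (\<tau> * (r - x)))" for \<tau> r :: real
    have [measurable]: "case_prod k \<in> borel_measurable (lborel \<Otimes>\<^sub>M lborel)"
      unfolding k_def by measurable
    have ki: "integrable (lborel \<Otimes>\<^sub>M lborel) (case_prod k)"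
    proof (rule lborel_pair.Fubini_integrable)
      show "AE \<tau> in lborel. integrable lborel (\<lambda>r. case_prod k (\<tau>, r))"
      proof (intro AE_I2)
        fix \<tau>
        have "integrable lborel (\<lambda>r. of_real (exp (- (e * \<tau>)\<^sup>2 / 2)) * u r)"
          using int by simp
        then show "integrable lborel (\<lambda>r. case_prod k (\<tau>, r))"
          by (rule Bochner_Integration.integrable_bound) (auto simp: k_def norm_mult)
      qed
      have "(\<lambda>\<tau>. LBINT r. norm (case_prod k (\<tau>, r))) = (\<lambda>\<tau>. exp (- (e * \<tau>)\<^sup>2 / 2) * (LBINT r. norm (u r)))"
        by (simp add: k_def norm_mult)
      then show "integrable lborel (\<lambda>\<tau>. LBINT r. norm (case_prod k (\<tau>, r)))"
        using gint[OF e] by simp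
    qed simp
    have "of_real (exp (- (e * \<tau>)\<^sup>2 / 2)) * (U \<tau> * iexp (- (\<tau> * x))) = (LBINT r. k \<tau> r)" for \<tau>
    proof -
      have "(LBINT r. k \<tau> r) = (LBINT r. (of_real (exp (- (e * \<tau>)\<^sup>2 / 2)) * iexp (- (\<tau> * x))) * (u r * iexp (\<tau> * r)))"
        unfolding k_def
        by (intro Bochner_Integration.integral_cong)
           (auto simp: algebra_simps exp_diff exp_minus field_simps)
      then show ?thesis unfolding integral_mult_right_zero by (simp add: U_def mult_ac)
    qed
    then have "(LBINT \<tau>. of_real (exp (- (e * \<tau>)\<^sup>2 / 2)) * (U \<tau> * iexp (- (\<tau> * x)))) = (LBINT \<tau>. LBINT r. k \<tau> r)"
      by simp
    also have "\<dots> = (LBINT r. LBINT \<tau>. k \<tau> r)"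
      by (rule lborel_pair.Fubini_integral[OF ki, symmetric])
    also have "\<dots> = (LBINT r. u r * of_real (2 * pi / e * std_normal_density ((r - x) / e)))"
    proof (intro Bochner_Integration.integral_cong refl)
      fix r
      have "(LBINT \<tau>. k \<tau> r) = (LBINT \<tau>. u r * (of_real (exp (- (e * \<tau>)\<^sup>2 / 2)) * iexp (\<tau> * (r - x))))"
        by (simp add: k_def mult_ac)
      then show "(LBINT \<tau>. k \<tau> r) = u r * of_real (2 * pi / e * std_normal_density ((r - x) / e))"
        by (simp only: integral_mult_right_zero gauss[OF e])
    qed
    also have "\<dots> = e *\<^sub>R (LBINT s. u (x + e * s) * of_real (2 * pi / e * std_normal_density s))"
      using lborel_integral_real_affine[of e "\<lambda>r. u r * of_real (2 * pi / e * std_normal_density ((r - x) / e))" x] e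
      by simp
    also have "\<dots> = e *\<^sub>R (LBINT s. of_real (2 * pi / e) * (std_normal_density s *\<^sub>R u (x + e * s)))"
      by (simp add: scaleR_conv_of_real mult_ac)
    also have "\<dots> = 2 * of_real pi * (LBINT s. std_normal_density s *\<^sub>R u (x + e * s))"
      using e unfolding integral_mult_right_zero by (simp add: scaleR_conv_of_real)
    finally show ?thesis .
  qed
  define \<epsilon> where "\<epsilon> n = 1 / (real n + 1)" for n
  have e0: "\<epsilon> n > 0" for n by (simp add: \<epsilon>_def)
  have elim: "\<epsilon> \<longlonglongrightarrow> 0"
    using LIMSEQ_inverse_real_of_nat by (simp add: \<epsilon>_def[abs_def] inverse_eq_divide add.commute)
  have L1: "(\<lambda>n. LBINT \<tau>. of_real (exp (- (\<epsilon> n * \<tau>)\<^sup>2 / 2)) * (U \<tau> * iexp (- (\<tau> * x))))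
      \<longlonglongrightarrow> (LBINT \<tau>. U \<tau> * iexp (- (\<tau> * x)))"
  proof (rule integral_dominated_convergence[where w = "\<lambda>\<tau>. norm (U \<tau>)"])
    show "AE \<tau> in lborel. (\<lambda>n. of_real (exp (- (\<epsilon> n * \<tau>)\<^sup>2 / 2)) * (U \<tau> * iexp (- (\<tau> * x)))) \<longlonglongrightarrow> U \<tau> * iexp (- (\<tau> * x))"
    proof (rule AE_I2)
      fix \<tau>
      have "(\<lambda>n. of_real (exp (- (\<epsilon> n * \<tau>)\<^sup>2 / 2)) * (U \<tau> * iexp (- (\<tau> * x)))) \<longlonglongrightarrow> of_real (exp (- (0 * \<tau>)\<^sup>2 / 2)) * (U \<tau> * iexp (- (\<tau> * x)))"
        by (intro tendsto_intros elim) auto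
      then show "(\<lambda>n. of_real (exp (- (\<epsilon> n * \<tau>)\<^sup>2 / 2)) * (U \<tau> * iexp (- (\<tau> * x)))) \<longlonglongrightarrow> U \<tau> * iexp (- (\<tau> * x))"
        by simp
    qed
    show "\<And>n. AE \<tau> in lborel. norm (of_real (exp (- (\<epsilon> n * \<tau>)\<^sup>2 / 2)) * (U \<tau> * iexp (- (\<tau> * x)))) \<le> norm (U \<tau>)"
      by (intro AE_I2) (auto simp: norm_mult intro!: mult_left_le_one_le)
  qed (use U in auto)
  have L2: "(\<lambda>n. LBINT s. std_normal_density s *\<^sub>R u (x + \<epsilon> n * s)) \<longlonglongrightarrow> (LBINT s. std_normal_density s *\<^sub>R u x)"
  proof (rule integral_dominated_convergence[where w = "\<lambda>s. std_normal_density s * B"])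
    show "AE s in lborel. (\<lambda>n. std_normal_density s *\<^sub>R u (x + \<epsilon> n * s)) \<longlonglongrightarrow> std_normal_density s *\<^sub>R u x"
    proof (rule AE_I2)
      fix s
      have "(\<lambda>n. x + \<epsilon> n * s) \<longlonglongrightarrow> x + 0 * s"
        by (intro tendsto_intros elim)
      then have "(\<lambda>n. u (x + \<epsilon> n * s)) \<longlonglongrightarrow> u x"
        using cont by (intro isCont_tendsto_compose[of x u]) (auto simp: continuous_on_eq_continuous_at)
      then show "(\<lambda>n. std_normal_density s *\<^sub>R u (x + \<epsilon> n * s)) \<longlonglongrightarrow> std_normal_density s *\<^sub>R u x"
        by (intro tendsto_intros)
    qed
    show "\<And>n. AE s in lborel. norm (std_normal_density s *\<^sub>R u (x + \<epsilon> n * s)) \<le> std_normal_density s * B"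
      by (intro AE_I2) (auto intro!: mult_left_mono bnd)
  qed (auto intro!: integrable_normal_density)
  have "(LBINT s. std_normal_density s *\<^sub>R u x) = u x"
    by simp
  with L2 have "(\<lambda>n. 2 * of_real pi * (LBINT s. std_normal_density s *\<^sub>R u (x + \<epsilon> n * s))) \<longlonglongrightarrow> 2 * of_real pi * u x"
    by (intro tendsto_intros) simp
  with L1 have "(LBINT \<tau>. U \<tau> * iexp (- (\<tau> * x))) = 2 * of_real pi * u x"
    unfolding J[OF e0] by (rule LIMSEQ_unique)
  then show ?thesis by (simp add: U_def)
qed

text \<open>
  In the variable \<open>t = e\<^bsup>-x\<^esup>\<close> the hypothesis says that all polynomials integrate to \<open>0\<close> against the integrable
  function \<open>e\<^bsup>-\<sigma>x\<^esup> u(x)\<close>.  By the theorem of Weierstrass every continuous function on \<open>[0,1]\<close> then does, and a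
  bump near a point with \<open>u(x\<^sub>0) \<noteq> 0\<close> gives a contradiction.
\<close>

theorem Laplace_uniqueness:
  fixes u :: "real \<Rightarrow> complex"
  assumes cont: "continuous_on {0<..} u"
    and int: "set_integrable lborel {0<..} (\<lambda>x. of_real (exp (- \<sigma> * x)) * u x)"
    and zero: "\<And>n::nat. (LBINT x:{0<..}. of_real (exp (- (\<sigma> + n) * x)) * u x) = 0"
    and x: "x0 > 0"
  shows "u x0 = 0"
proof (rule ccontr)
  assume nz: "u x0 \<noteq> 0"
  define v where "v x = indicator {0<..} x *\<^sub>R (of_real (exp (- \<sigma> * x)) * u x)" for x
  have v: "integrable lborel v" using int by (simp add: v_def[abs_def] set_integrable_def)
  have [measurable]: "v \<in> borel_measurable borel" using borel_measurable_integrable[OF v] by simp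
  have vb: "integrable lborel (\<lambda>x. of_real (c (exp (- x))) * v x)"
    if [measurable]: "c \<in> borel_measurable borel" and b: "\<And>t. t \<in> {0..1} \<Longrightarrow> \<bar>c t\<bar> \<le> K" for c and K :: real
  proof (rule Bochner_Integration.integrable_bound[OF integrable_norm[OF integrable_mult_right[OF v, of "of_real K"]]])
    have "K \<ge> 0" using b[of 0] by auto
    have "norm (of_real (c (exp (- x))) * v x) \<le> K * norm (v x)" for x
    proof (cases "x > 0")
      case True
      then show ?thesis using b[of "exp (- x)"] by (auto simp: norm_mult intro!: mult_right_mono)
    qed (simp add: v_def)
    then show "AE x in lborel. norm (of_real (c (exp (- x))) * v x) \<le> norm (norm (of_real K * v x))"
      using \<open>K \<ge> 0\<close> by (simp add: norm_mult)
  qed auto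
  have mono: "(LBINT x. of_real (exp (- x) ^ n) * v x) = 0" for n
  proof -
    have "of_real (exp (- x) ^ n) * v x = indicator {0<..} x *\<^sub>R (of_real (exp (- (\<sigma> + n) * x)) * u x)" for x
    proof -
      have "exp (- x) ^ n * exp (- \<sigma> * x) = exp (- (\<sigma> + n) * x)"
        by (simp add: exp_of_nat_mult[symmetric] exp_add[symmetric] algebra_simps)
      then have "complex_of_real (exp (- x) ^ n) * of_real (exp (- \<sigma> * x)) = of_real (exp (- (\<sigma> + n) * x))"
        by (simp only: of_real_mult[symmetric])
      then show ?thesis
        by (simp only: v_def mult_scaleR_right mult.assoc[symmetric])
    qed
    then show ?thesis using zero[of n] by (simp add: set_lebesgue_integral_def)
  qed
  have poly: "(LBINT x. of_real (q (exp (- x))) * v x) = 0" if qp: "real_polynomial_function q" for q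
  proof -
    obtain a n where q: "q = (\<lambda>t. \<Sum>i\<le>n. a i * t ^ i)"
      using qp real_polynomial_function_iff_sum by blast
    have "(LBINT x. of_real (q (exp (- x))) * v x) = (LBINT x. \<Sum>i\<le>n. of_real (a i) * (of_real (exp (- x) ^ i) * v x))"
      by (simp add: q sum_distrib_right mult.assoc)
    also have "\<dots> = (\<Sum>i\<le>n. LBINT x. of_real (a i) * (of_real (exp (- x) ^ i) * v x))"
    proof (rule Bochner_Integration.integral_sum)
      fix i
      have "integrable lborel (\<lambda>x. of_real (exp (- x) ^ i) * v x)"
      proof (rule vb[where c = "\<lambda>t. t ^ i" and K = 1])
        show "\<bar>t ^ i\<bar> \<le> 1" if "t \<in> {0..1}" for t :: real
          using that power_le_one[of t i] zero_le_power[of t i] by simp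
      qed simp
      then show "integrable lborel (\<lambda>x. of_real (a i) * (of_real (exp (- x) ^ i) * v x))"
        by (rule integrable_mult_right)
    qed
    also have "\<dots> = 0" by (simp only: integral_mult_right_zero mono) simp
    finally show ?thesis .
  qed
  have test: "(LBINT x. of_real (c (exp (- x))) * v x) = 0" if c: "continuous_on UNIV c" for c :: "real \<Rightarrow> real"
  proof -
    have [measurable]: "c \<in> borel_measurable borel" using c by (rule borel_measurable_continuous_onI)
    have "compact (c ` {0..1})" using c by (intro compact_continuous_image) (auto intro: continuous_on_subset)
    then have "bounded (c ` {0..1})" by (rule compact_imp_bounded)
    then obtain K where K: "\<And>t. t \<in> {0..1} \<Longrightarrow> \<bar>c t\<bar> \<le> K"
      unfolding bounded_iff by (metis imageI real_norm_def)
    let ?I = "LBINT x. of_real (c (exp (- x))) * v x"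
    have "norm ?I \<le> e" if e: "e > 0" for e
    proof -
      define M where "M = (LBINT x. norm (v x)) + 1"
      have M: "M > 0" by (simp add: M_def add_nonneg_pos)
      obtain q where q: "real_polynomial_function q" "\<And>t. t \<in> {0..1} \<Longrightarrow> \<bar>c t - q t\<bar> < e / M"
        using Stone_Weierstrass_real_polynomial_function[of "{0..1}" c "e / M"] c e M
        by (auto intro: continuous_on_subset)
      have [measurable]: "q \<in> borel_measurable borel"
        using q(1) by (intro borel_measurable_continuous_onI) 
          (auto simp: continuous_on_eq_continuous_at continuous_real_polymonial_function)
      have qK: "\<bar>q t\<bar> \<le> K + e / M" if "t \<in> {0..1}" for t
        using q(2)[OF that] K[OF that] by linarith
      have dint: "integrable lborel (\<lambda>x. of_real (c (exp (- x)) - q (exp (- x))) * v x)"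
        by (rule vb[where c = "\<lambda>t. c t - q t" and K = "e / M"]) (auto intro!: less_imp_le q(2))
      have "?I = ?I - (LBINT x. of_real (q (exp (- x))) * v x)" by (simp add: poly[OF q(1)])
      also have "\<dots> = (LBINT x. of_real (c (exp (- x))) * v x - of_real (q (exp (- x))) * v x)"
        by (rule Bochner_Integration.integral_diff[symmetric]) (auto intro!: vb K qK)
      also have "\<dots> = (LBINT x. of_real (c (exp (- x)) - q (exp (- x))) * v x)"
        by (simp add: algebra_simps)
      also have "norm \<dots> \<le> (LBINT x. e / M * norm (v x))"
      proof (rule Bochner_Integration.integral_norm_bound_integral[OF dint])
        fix x
        show "norm (of_real (c (exp (- x)) - q (exp (- x))) * v x) \<le> e / M * norm (v x)"
        proof (cases "x > 0")
          case True
          then show ?thesis using q(2)[of "exp (- x)"] unfolding norm_mult norm_of_real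
            by (intro mult_right_mono) auto
        qed (simp add: v_def)
      qed (use v in auto)
      also have "\<dots> = e * ((LBINT x. norm (v x)) / M)" by simp
      also have "\<dots> \<le> e * 1"
        using e M by (intro mult_left_mono) (auto simp: M_def)
      finally show ?thesis by simp
    qed
    then have "norm ?I \<le> 0" by (rule field_le_epsilon) (simp only: add_0)
    then show ?thesis by simp
  qed
  have "isCont u x0" using cont x by (auto simp: continuous_on_eq_continuous_at)
  then have "isCont (\<lambda>x. Re (cnj (u x0) * u x)) x0"
    unfolding isCont_def by (intro tendsto_intros)
  moreover have "Re (cnj (u x0) * u x0) > 0"
    using nz by (simp add: complex_eq_iff flip: power2_eq_square) (simp add: sum_power2_gt_zero_iff)
  ultimately have "eventually (\<lambda>x. Re (cnj (u x0) * u x) > 0) (at x0)"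
    using order_tendstoD(1) isContD by blast
  then obtain d0 where d0: "d0 > 0" "\<And>x. \<bar>x - x0\<bar> < d0 \<Longrightarrow> Re (cnj (u x0) * u x) > 0"
    unfolding eventually_at using \<open>Re (cnj (u x0) * u x0) > 0\<close> by (auto simp: dist_real_def) metis
  \<comment> \<open>The tent \<open>c\<close> is positive at \<open>e\<^bsup>-x\<^esup>\<close> exactly where \<open>|x - x\<^sub>0| < d\<close>, an interval on which
      \<open>Re (cnj (u x0) * u x)\<close> is positive.\<close>
  define d where "d = min d0 x0"
  have d: "d > 0" "d \<le> x0" "d \<le> d0" using d0 x by (auto simp: d_def)
  define c where "c t = max 0 (min (t - exp (- (x0 + d))) (exp (- (x0 - d)) - t))" for t :: real
  have cpos: "c (exp (- x)) > 0 \<longleftrightarrow> \<bar>x - x0\<bar> < d" for x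
    by (auto simp: c_def abs_less_iff less_max_iff_disj)
  have c0: "c t \<ge> 0" for t by (simp add: c_def)
  have cc: "continuous_on UNIV c" unfolding c_def by (intro continuous_intros)
  have [measurable]: "c \<in> borel_measurable borel" using cc by (rule borel_measurable_continuous_onI)
  define w where "w x = Re (cnj (u x0) * (of_real (c (exp (- x))) * v x))" for x
  have cvint: "integrable lborel (\<lambda>x. of_real (c (exp (- x))) * v x)"
  proof (rule vb[where K = 1])
    fix t :: real assume "t \<in> {0..1}"
    then have "t \<le> 1" by simp
    with exp_gt_zero[of "- (x0 + d)"] have "t - exp (- (x0 + d)) \<le> 1" by linarith
    then have "c t \<le> 1" unfolding c_def by (intro max.boundedI min.coboundedI1) auto
    then show "\<bar>c t\<bar> \<le> 1" using c0[of t] by simp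
  qed simp
  have wint: "integrable lborel w"
    unfolding w_def by (rule integrable_Re[OF integrable_mult_right[OF cvint]])
  have "integral\<^sup>L lborel w = Re (cnj (u x0) * (LBINT x. of_real (c (exp (- x))) * v x))"
    unfolding w_def using integral_Re[OF integrable_mult_right[OF cvint, of "cnj (u x0)"]]
    by (simp only: integral_mult_right_zero)
  then have w0: "integral\<^sup>L lborel w = 0" by (simp add: test[OF cc])
  have wv: "w x = c (exp (- x)) * exp (- \<sigma> * x) * Re (cnj (u x0) * u x)" if "\<bar>x - x0\<bar> < d" for x
  proof -
    have "x > 0" using that d by linarith
    then show ?thesis by (simp add: w_def v_def algebra_simps)
  qed
  have wpos: "w x > 0" if "\<bar>x - x0\<bar> < d" for x
    unfolding wv[OF that] using that d cpos[of x] d0(2)[of x] by simp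
  have wnn: "w x \<ge> 0" for x
  proof (cases "\<bar>x - x0\<bar> < d")
    case False
    then have "c (exp (- x)) = 0" using cpos[of x] c0[of "exp (- x)"] by linarith
    then show ?thesis by (simp add: w_def)
  qed (use wpos in \<open>auto intro: less_imp_le\<close>)
  have "AE x in lborel. w x = 0"
    using integral_nonneg_eq_0_iff_AE[OF wint] wnn w0 by simp
  then have "AE x in lborel. x \<notin> {x0 - d<..<x0 + d}"
  proof eventually_elim
    case (elim x)
    then show ?case using wpos[of x] by (auto simp: abs_less_iff)
  qed
  then have "emeasure lborel {x0 - d<..<x0 + d} = 0"
    by (subst (asm) AE_iff_measurable[where N = "{x0 - d<..<x0 + d}"]) auto
  then show False using d by simp
qed

section \<open>Macdonald functions as exponential integrals\<close>

lemma exp_minus_le_fact_over_power: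
  assumes "x > (0::real)"
  shows "exp (- x) \<le> fact n / x ^ n"
proof -
  have "x ^ n / fact n \<le> (\<Sum>k. x ^ k / fact k)"
    using sum_le_suminf[of "\<lambda>k. x ^ k / fact k" "{n}"] summable_exp[of x] assms
    by (simp add: divide_inverse mult.commute)
  also have "\<dots> = exp x" by (simp add: exp_def divide_inverse mult.commute)
  finally have "x ^ n / fact n \<le> exp x" .
  then show ?thesis using assms by (simp add: exp_minus field_simps)
qed

text \<open>
  At \<open>+\<infinity>\<close> the factor \<open>exp (- p e\<^sup>r)\<close> dominates.  At \<open>-\<infinity>\<close> the other one beats every power of \<open>e\<^sup>r\<close>; trading it
  for a sufficiently high power leaves a convergent Gamma integral.
\<close>

lemma integrable_Macdonald:
  assumes pq: "p > 0" "q > 0"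
  shows "integrable lborel (\<lambda>r. exp (z * of_real r - of_real (p * exp r + q * exp (- r))) :: complex)"
proof -
  obtain n :: nat where "- Re z < n" using reals_Archimedean2 by blast
  then have n: "Re z + n > 0" by simp
  let ?b = "\<lambda>r. of_real (fact n / q ^ n) * exp ((z + of_nat n) * of_real r - of_real (p * exp r)) :: complex"
  have "integrable lborel ?b"
    using n pq by (intro integrable_mult_right Gamma_integral_exp(1)) auto
  then show ?thesis
  proof (rule Bochner_Integration.integrable_bound)
    show "AE r in lborel. norm (exp (z * of_real r - of_real (p * exp r + q * exp (- r)))) \<le> norm (?b r)"
    proof (rule AE_I2)
      fix r :: real
      have "exp (- (q * exp (- r))) \<le> fact n / (q * exp (- r)) ^ n"
        using pq by (intro exp_minus_le_fact_over_power) auto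
      also have "\<dots> = fact n / q ^ n * exp (n * r)"
      proof -
        have "(q * exp (- r)) ^ n = q ^ n * exp (- (n * r))"
          by (simp add: power_mult_distrib flip: exp_of_nat_mult)
        then show ?thesis by (simp add: exp_minus field_simps)
      qed
      finally have "exp (Re z * r - p * exp r) * exp (- (q * exp (- r))) \<le>
          exp (Re z * r - p * exp r) * (fact n / q ^ n * exp (n * r))"
        by (intro mult_left_mono) auto
      also have "exp (Re z * r - p * exp r) * (fact n / q ^ n * exp (n * r)) =
          fact n / q ^ n * exp ((Re z + n) * r - p * exp r)"
        by (simp add: exp_add exp_diff algebra_simps)
      finally show "norm (exp (z * of_real r - of_real (p * exp r + q * exp (- r)))) \<le> norm (?b r)"
        using pq by (simp add: norm_mult norm_divide norm_power norm_exp_eq_Re exp_add[symmetric] algebra_simps)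
    qed
  qed simp
qed

lemma lborel_integral_reflect_positive:
  fixes k :: "real \<Rightarrow> 'a::euclidean_space"
  assumes k: "integrable lborel k"
  shows "(LBINT r. k r) = (LBINT r:{0<..}. k r + k (- r))"
proof -
  have i: "set_integrable lborel A k" if "A \<in> sets borel" for A
    unfolding set_integrable_def using k that by (intro integrable_mult_indicator) auto
  have k': "integrable lborel (\<lambda>r. k (- r))"
    using lborel_integrable_real_affine[OF k, of "-1" 0] by simp
  then have i': "set_integrable lborel {0<..} (\<lambda>r. k (- r))"
    unfolding set_integrable_def by (intro integrable_mult_indicator) auto
  have "(LBINT r. k r) = (LBINT r:{0<..} \<union> {..0}. k r)"
  proof -
    have "{0<..} \<union> {..0::real} = UNIV" by auto
    then show ?thesis by (simp add: set_lebesgue_integral_def)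
  qed
  also have "\<dots> = (LBINT r:{0<..}. k r) + (LBINT r:{..0}. k r)"
    by (rule set_integral_Un) (auto intro: i)
  also have "(LBINT r:{..0}. k r) = (LBINT r. indicator {..0} (- r) *\<^sub>R k (- r))"
    using lborel_integral_real_affine[of "-1" "\<lambda>r. indicator {..0} r *\<^sub>R k r" 0]
    by (simp add: set_lebesgue_integral_def)
  also have "\<dots> = (LBINT r:{0<..}. k (- r))"
    unfolding set_lebesgue_integral_def
  proof (rule integral_cong_AE)
    have [measurable]: "k \<in> borel_measurable borel" using borel_measurable_integrable[OF k] by simp
    show "(\<lambda>r. indicator {..0} (- r) *\<^sub>R k (- r)) \<in> borel_measurable lborel"
         "(\<lambda>r. indicator {0<..} r *\<^sub>R k (- r)) \<in> borel_measurable lborel" by simp_all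
    have "AE r in lborel. r \<noteq> (0::real)" by (rule AE_lborel_singleton)
    then show "AE r in lborel. indicator {..0} (- r) *\<^sub>R k (- r) = indicator {0<..} r *\<^sub>R k (- r)"
      by eventually_elim (auto simp: indicator_def)
  qed
  also have "(LBINT r:{0<..}. k r) + (LBINT r:{0<..}. k (- r)) = (LBINT r:{0<..}. k r + k (- r))"
    by (rule set_integral_add(2)[symmetric]) (auto intro: i i')
  finally show ?thesis .
qed

text \<open>
  Translating \<open>r\<close> by \<open>ln (q/p) / 2\<close> makes the two coefficients equal, so that the exponent becomes
  \<open>- 2\<surd>(pq) cosh r\<close>.  Folding the line at \<open>0\<close> gives the integral that defines \<open>K\<close>.
\<close>

lemma Macdonald_integral_eq_bessel_K:
  assumes pq: "p > 0" "q > 0"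
  shows "(LBINT r. exp (z * of_real r - of_real (p * exp r + q * exp (- r)))) =
    2 * of_real (q / p) powr (z / 2) * bessel_K z (2 * sqrt (p * q))"
proof -
  define c where "c = ln (q / p) / 2"
  define X where "X = sqrt (p * q)"
  have X: "X > 0" using pq by (simp add: X_def)
  have lnX: "ln X = (ln p + ln q) / 2" using pq by (simp add: X_def ln_sqrt ln_mult)
  have pc: "p * exp c = X" and qc: "q * exp (- c) = X"
  proof -
    have "p * exp c = exp (ln p + c)" using pq by (simp add: exp_add)
    also have "ln p + c = ln X" using pq by (simp add: c_def lnX ln_div field_simps)
    finally show "p * exp c = X" using X by simp
    have "q * exp (- c) = exp (ln q - c)" using pq by (simp add: exp_diff exp_minus field_simps)
    also have "ln q - c = ln X" using pq by (simp add: c_def lnX ln_div field_simps)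
    finally show "q * exp (- c) = X" using X by simp
  qed
  let ?k = "\<lambda>r. exp (z * of_real r - of_real (X * exp r + X * exp (- r))) :: complex"
  have ki: "integrable lborel ?k" using X by (intro integrable_Macdonald)
  have zc: "of_real (q / p) powr (z / 2) = exp (z * of_real c)"
    using pq Ln_of_real[of "q / p"] by (simp add: powr_def c_def)
  have "(LBINT r. exp (z * of_real r - of_real (p * exp r + q * exp (- r)))) =
      (LBINT r. exp (z * of_real (r + c) - of_real (p * exp (r + c) + q * exp (- (r + c)))))"
    using lborel_integral_shift(1)[of "\<lambda>r. exp (z * of_real r - of_real (p * exp r + q * exp (- r)))" c] by simp
  also have "\<dots> = (LBINT r. of_real (q / p) powr (z / 2) * ?k r)"
  proof (intro Bochner_Integration.integral_cong refl)
    fix r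
    have "p * exp (r + c) + q * exp (- (r + c)) = (p * exp c) * exp r + (q * exp (- c)) * exp (- r)"
      by (simp add: exp_add exp_diff exp_minus field_simps)
    then have e: "p * exp (r + c) + q * exp (- (r + c)) = X * exp r + X * exp (- r)"
      by (simp only: pc qc)
    show "exp (z * of_real (r + c) - of_real (p * exp (r + c) + q * exp (- (r + c)))) =
       of_real (q / p) powr (z / 2) * ?k r"
      unfolding e zc exp_add[symmetric] by (rule arg_cong[of _ _ exp]) (simp add: algebra_simps)
  qed
  also have "\<dots> = of_real (q / p) powr (z / 2) * (LBINT r:{0<..}. ?k r + ?k (- r))"
    unfolding integral_mult_right_zero lborel_integral_reflect_positive[OF ki] ..
  also have "(LBINT r:{0<..}. ?k r + ?k (- r)) = (LBINT r:{0<..}. 2 * (of_real (exp (- (2 * X) * cosh r)) * cosh (z * of_real r)))"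
  proof (intro set_lebesgue_integral_cong allI impI)
    fix r :: real
    define A where "A = X * exp r + X * exp (- r)"
    have 1: "?k r = exp (- of_real A) * exp (z * of_real r)"
      unfolding exp_add[symmetric] A_def by (rule arg_cong[of _ _ exp]) (simp add: algebra_simps)
    have 2: "?k (- r) = exp (- of_real A) * exp (- (z * of_real r))"
      unfolding exp_add[symmetric] A_def by (rule arg_cong[of _ _ exp]) (simp add: algebra_simps)
    have "- (2 * X) * cosh r = - A" by (simp add: A_def cosh_field_def field_simps)
    then have 3: "of_real (exp (- (2 * X) * cosh r)) = exp (- complex_of_real A)"
      by (simp only: exp_of_real[symmetric] of_real_minus)
    show "?k r + ?k (- r) = 2 * (of_real (exp (- (2 * X) * cosh r)) * cosh (z * of_real r))"
      unfolding 1 2 3 by (simp add: cosh_field_def algebra_simps)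
  qed simp
  also have "\<dots> = 2 * bessel_K z (2 * X)"
    by (simp add: bessel_K_def)
  finally show ?thesis by (simp add: X_def)
qed

definition Macdonald_W :: "complex \<Rightarrow> real \<Rightarrow> complex" where
  "Macdonald_W z x = (LBINT r. exp (z * of_real r - of_real (exp r + x * exp (- r))))"

lemma Macdonald_W_eq_bessel_K:
  assumes "x > 0"
  shows "Macdonald_W z x = 2 * of_real x powr (z / 2) * bessel_K z (2 * sqrt x)"
  using Macdonald_integral_eq_bessel_K[of 1 x z] assms by (simp add: Macdonald_W_def)

text \<open>
  For real order the integrand is positive, which makes \<open>W\<close> the natural weight for absolute convergence.
\<close>

lemma Macdonald_W_of_real:
  assumes x: "x > 0"
  shows "Macdonald_W (of_real \<gamma>) x = of_real (LBINT r. exp (\<gamma> * r - (exp r + x * exp (- r))))"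
    and "Macdonald_W (of_real \<gamma>) x = of_real (norm (Macdonald_W (of_real \<gamma>) x))"
    and "Macdonald_W (of_real \<gamma>) x \<noteq> 0"
proof -
  have e: "exp (of_real \<gamma> * of_real r - of_real (exp r + x * exp (- r)))
      = complex_of_real (exp (\<gamma> * r - (exp r + x * exp (- r))))" for r
    by (simp flip: exp_of_real)
  show 1: "Macdonald_W (of_real \<gamma>) x = of_real (LBINT r. exp (\<gamma> * r - (exp r + x * exp (- r))))"
    unfolding Macdonald_W_def e by simp
  have i: "integrable lborel (\<lambda>r. exp (\<gamma> * r - (exp r + x * exp (- r))))"
    using integrable_Macdonald[of 1 x "of_real \<gamma>"] x unfolding mult_1 e complex_of_real_integrable_eq by simp
  have "(LBINT r. exp (\<gamma> * r - (exp r + x * exp (- r)))) \<noteq> 0"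
  proof
    assume "(LBINT r. exp (\<gamma> * r - (exp r + x * exp (- r)))) = 0"
    then have "AE r::real in lborel. False"
      using integral_nonneg_eq_0_iff_AE[OF i] by simp
    then show False using AE_iff_measurable[of UNIV lborel "\<lambda>_::real. False"] by simp
  qed
  then show "Macdonald_W (of_real \<gamma>) x \<noteq> 0" by (simp add: 1)
  have "(LBINT r. exp (\<gamma> * r - (exp r + x * exp (- r)))) \<ge> 0" by simp
  then show "Macdonald_W (of_real \<gamma>) x = of_real (norm (Macdonald_W (of_real \<gamma>) x))"
    by (simp add: 1)
qed

lemma norm_Macdonald_W_le:
  assumes x: "x > 0"
  shows "norm (Macdonald_W z x) \<le> norm (Macdonald_W (of_real (Re z)) x)"
proof -
  have "norm (Macdonald_W z x) \<le> (LBINT r. norm (exp (z * of_real r - of_real (exp r + x * exp (- r)))))"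
    unfolding Macdonald_W_def by (rule integral_norm_bound)
  also have "\<dots> = (LBINT r. exp (Re z * r - (exp r + x * exp (- r))))"
    by (simp add: norm_exp_eq_Re)
  also have "\<dots> \<le> norm (Macdonald_W (of_real (Re z)) x)"
    by (simp add: Macdonald_W_of_real(1)[OF x])
  finally show ?thesis .
qed

lemma borel_measurable_Macdonald_W [measurable]: "Macdonald_W z \<in> borel_measurable borel"
  unfolding Macdonald_W_def[abs_def] by measurable

lemma borel_measurable_bessel_K [measurable]: "bessel_K z \<in> borel_measurable borel"
  unfolding bessel_K_def[abs_def] set_lebesgue_integral_def cosh_field_def by measurable

lemma integrable_pair_mult:
  fixes a b :: "real \<Rightarrow> complex"
  assumes a: "integrable lborel a" and b: "integrable lborel b"
  shows "integrable (lborel \<Otimes>\<^sub>M lborel) (\<lambda>(u, y). a u * b y)"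
    and "integral\<^sup>L (lborel \<Otimes>\<^sub>M lborel) (\<lambda>(u, y). a u * b y) = (LBINT u. a u) * (LBINT y. b y)"
proof -
  have [measurable]: "a \<in> borel_measurable borel" "b \<in> borel_measurable borel"
    using borel_measurable_integrable[OF a] borel_measurable_integrable[OF b] by auto
  show i: "integrable (lborel \<Otimes>\<^sub>M lborel) (\<lambda>(u, y). a u * b y)"
  proof (rule lborel_pair.Fubini_integrable)
    show "integrable lborel (\<lambda>u. LBINT y. norm (case (u, y) of (u, y) \<Rightarrow> a u * b y))"
      using a by (simp add: norm_mult)
    show "AE u in lborel. integrable lborel (\<lambda>y. case (u, y) of (u, y) \<Rightarrow> a u * b y)"
      using b by simp
  qed simp
  show "integral\<^sup>L (lborel \<Otimes>\<^sub>M lborel) (\<lambda>(u, y). a u * b y) = (LBINT u. a u) * (LBINT y. b y)"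
    using lborel_pair.integral_fst[OF i] by simp
qed

definition Macdonald_kernel :: "real \<Rightarrow> real \<Rightarrow> real \<Rightarrow> complex" where
  "Macdonald_kernel x u y = 2 * bessel_K 0 (2 * sqrt ((x + y) * (x + u) / x))"

lemma Macdonald_kernel_measurable [measurable (raw)]:
  assumes [measurable]: "X \<in> borel_measurable M" "U \<in> borel_measurable M" "Y \<in> borel_measurable M"
  shows "(\<lambda>w. Macdonald_kernel (X w) (U w) (Y w)) \<in> borel_measurable M"
  unfolding Macdonald_kernel_def by measurable

lemma Macdonald_kernel_exp:
  assumes "u > 0" "y > 0"
  shows "Macdonald_kernel (exp r) u y =
    (LBINT a. of_real (exp (- ((1 + y * exp (- r)) * exp a + (exp r + u) * exp (- a)))))"
proof -
  have "(LBINT a. exp (0 * of_real a - of_real ((1 + y * exp (- r)) * exp a + (exp r + u) * exp (- a)))) =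
    2 * of_real ((exp r + u) / (1 + y * exp (- r))) powr (0 / 2) * bessel_K 0 (2 * sqrt ((1 + y * exp (- r)) * (exp r + u)))"
    using assms by (intro Macdonald_integral_eq_bessel_K add_pos_pos) auto
  moreover have "(1 + y * exp (- r)) * (exp r + u) = (exp r + y) * (exp r + u) / exp r"
    by (simp add: exp_minus field_simps)
  moreover have "complex_of_real ((exp r + u) / (1 + y * exp (- r))) powr (0 / 2) = 1"
  proof -
    have "exp r + u > 0" "1 + y * exp (- r) > 0" using assms by (auto intro!: add_pos_pos)
    then have "complex_of_real ((exp r + u) / (1 + y * exp (- r))) \<noteq> 0"
      unfolding of_real_eq_0_iff by simp
    then show ?thesis by simp
  qed
  moreover have "exp (0 * of_real a - of_real b) = complex_of_real (exp (- b))" for a b :: real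
    by (simp flip: exp_of_real)
  ultimately show ?thesis
    by (simp only: Macdonald_kernel_def mult_1_right)
qed

text \<open>
  With \<open>x = e\<^sup>r\<close> and the parameter \<open>a\<close> of the exponential form of the kernel, the exponent splits into a function
  of \<open>a\<close> and a function of \<open>r - a\<close>, each of them the integrand of a Macdonald function.
\<close>

lemma Macdonald_kernel_Mellin_exp:
  assumes uy: "u > 0" "y > 0"
  shows "integrable lborel (\<lambda>r. exp (z * of_real r) * Macdonald_kernel (exp r) u y)"
    and "(LBINT r. exp (z * of_real r) * Macdonald_kernel (exp r) u y) = Macdonald_W z u * Macdonald_W z y"
proof -
  define k where "k a r = exp (z * of_real r) * of_real (exp (- ((1 + y * exp (- r)) * exp a + (exp r + u) * exp (- a))))" for a r :: real
  define E where "E s r = exp (z * of_real r - of_real (exp r + s * exp (- r)))" for s r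
  have Ei: "integrable lborel (E s)" if "s > 0" for s
    unfolding E_def using integrable_Macdonald[of 1 s z] that by simp
  have kE: "k a r = E u a * E y (r + (- a))" for a r
  proof -
    define P where "P = exp a + u * exp (- a)"
    define Q where "Q = exp (r + (- a)) + y * exp (- (r + (- a)))"
    have "(1 + y * exp (- r)) * exp a + (exp r + u) * exp (- a) = P + Q"
      by (simp add: P_def Q_def exp_diff exp_minus field_simps)
    moreover have "exp (z * of_real r) * of_real (exp (- (P + Q))) =
        exp (z * of_real a - of_real P) * exp (z * of_real (r + (- a)) - of_real Q)"
      unfolding exp_of_real[symmetric] exp_add[symmetric]
      by (rule arg_cong[of _ _ exp]) (simp add: algebra_simps)
    ultimately show ?thesis by (simp only: k_def E_def P_def Q_def)
  qed
  have k_meas [measurable]: "case_prod k \<in> borel_measurable (lborel \<Otimes>\<^sub>M lborel)"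
    unfolding k_def by measurable
  have ki: "integrable (lborel \<Otimes>\<^sub>M lborel) (case_prod k)"
  proof (rule lborel_pair.Fubini_integrable)
    have "integrable lborel (\<lambda>r. E y (r + (- a)))" for a
      using lborel_integral_shift(2)[of "E y" "- a"] Ei[OF uy(2)] by simp
    then show "AE a in lborel. integrable lborel (\<lambda>r. case_prod k (a, r))"
      by (simp add: kE)
    have "(LBINT r. norm (case_prod k (a, r))) = norm (E u a) * (LBINT r. norm (E y r))" for a
      using lborel_integral_shift(1)[of "\<lambda>r. norm (E y r)" "- a"] by (simp add: kE norm_mult)
    then show "integrable lborel (\<lambda>a. LBINT r. norm (case_prod k (a, r)))"
      using Ei[OF uy(1)] by simp
  qed simp
  have "(LBINT a. k a r) = exp (z * of_real r) * Macdonald_kernel (exp r) u y" for r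
    unfolding Macdonald_kernel_exp[OF uy] k_def by (simp only: integral_mult_right_zero)
  then have eq: "(\<lambda>r. exp (z * of_real r) * Macdonald_kernel (exp r) u y) = (\<lambda>r. LBINT a. k a r)"
    by simp
  show "integrable lborel (\<lambda>r. exp (z * of_real r) * Macdonald_kernel (exp r) u y)"
    unfolding eq by (rule lborel_pair.integrable_snd[OF ki])
  have "(LBINT r. LBINT a. k a r) = (LBINT a. LBINT r. k a r)"
    by (rule lborel_pair.Fubini_integral[OF ki])
  also have "\<dots> = (LBINT a. E u a * (LBINT r. E y r))"
    unfolding kE integral_mult_right_zero lborel_integral_shift(1)[of "E y"] ..
  also have "\<dots> = Macdonald_W z u * Macdonald_W z y"
    by (simp add: E_def[abs_def] Macdonald_W_def)
  finally show "(LBINT r. exp (z * of_real r) * Macdonald_kernel (exp r) u y) = Macdonald_W z u * Macdonald_W z y"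
    unfolding eq .
qed

lemma Macdonald_kernel_Mellin:
  assumes uy: "u > 0" "y > 0"
  shows "set_integrable lborel {0<..} (\<lambda>x. of_real x powr (z - 1) * Macdonald_kernel x u y)"
    and "(LBINT x:{0<..}. of_real x powr (z - 1) * Macdonald_kernel x u y) = Macdonald_W z u * Macdonald_W z y"
proof -
  let ?k = "\<lambda>x. of_real x powr (z - 1) * Macdonald_kernel x u y"
  have m: "set_borel_measurable borel {0<..} ?k"
    unfolding set_borel_measurable_def by measurable
  have E: "exp r *\<^sub>R ?k (exp r) = exp (z * of_real r) * Macdonald_kernel (exp r) u y" for r
    by (simp add: powr_def exp_diff exp_of_real[symmetric] Ln_of_real scaleR_conv_of_real algebra_simps)
  show "set_integrable lborel {0<..} ?k"
    using integral_exp_substitution(1)[OF m] Macdonald_kernel_Mellin_exp(1)[OF uy] unfolding E by simp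
  show "(LBINT x:{0<..}. ?k x) = Macdonald_W z u * Macdonald_W z y"
    using integral_exp_substitution(2)[OF m] Macdonald_kernel_Mellin_exp(2)[OF uy] unfolding E by simp
qed

lemma norm_Macdonald_kernel_Mellin:
  assumes uy: "u > 0" "y > 0"
  shows "(LBINT x:{0<..}. norm (of_real x powr (z - 1) * Macdonald_kernel x u y)) =
    norm (Macdonald_W (of_real (Re z)) u) * norm (Macdonald_W (of_real (Re z)) y)"
proof -
  have nn: "Macdonald_kernel x u y = of_real (norm (Macdonald_kernel x u y))" if "x > 0" for x
  proof -
    have "Macdonald_kernel x u y \<in> \<real>\<^sub>\<ge>\<^sub>0"
      using Macdonald_kernel_exp[OF uy, of "ln x"] that by simp
    then show ?thesis by (auto elim!: nonneg_Reals_cases)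
  qed
  have "complex_of_real (LBINT x:{0<..}. norm (of_real x powr (z - 1) * Macdonald_kernel x u y)) =
    (LBINT x:{0<..}. of_real (norm (of_real x powr (z - 1) * Macdonald_kernel x u y)))"
    by (simp add: set_integral_complex_of_real)
  also have "\<dots> = (LBINT x:{0<..}. of_real x powr (of_real (Re z) - 1) * Macdonald_kernel x u y)"
  proof (intro set_lebesgue_integral_cong allI impI)
    fix x :: real assume "x \<in> {0<..}"
    then have x: "x > 0" by simp
    show "of_real (norm (of_real x powr (z - 1) * Macdonald_kernel x u y)) =
      of_real x powr (of_real (Re z) - 1) * Macdonald_kernel x u y"
      using x by (subst (2) nn[OF x]) (simp add: norm_mult norm_powr_real_powr powr_of_real[symmetric])
  qed simp
  also have "\<dots> = Macdonald_W (of_real (Re z)) u * Macdonald_W (of_real (Re z)) y"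
    by (rule Macdonald_kernel_Mellin(2)[OF uy])
  also have "\<dots> = of_real (norm (Macdonald_W (of_real (Re z)) u) * norm (Macdonald_W (of_real (Re z)) y))"
    using Macdonald_W_of_real(2)[of u "Re z"] Macdonald_W_of_real(2)[of y "Re z"] uy by simp
  finally show ?thesis by (simp only: of_real_eq_iff)
qed

section \<open>The convolution theorem\<close>

text \<open>
  All exchanges of integration are between \<open>x\<close> and the pair \<open>(u, y)\<close>.  Absolute convergence holds because the
  product formula for the kernel, applied to absolute values, reduces it to that of the two factors on
  the right at the real order \<open>Re z\<close>.
\<close>

theorem Mellin_Macdonald_convolution:
  fixes h f :: "real \<Rightarrow> complex"
  assumes [measurable]: "h \<in> borel_measurable borel" "f \<in> borel_measurable borel"
    and supp: "\<And>x. x \<le> 0 \<Longrightarrow> h x = 0" "\<And>x. x \<le> 0 \<Longrightarrow> f x = 0"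
    and h: "integrable lborel (\<lambda>u. h u * Macdonald_W (of_real (Re z)) u)"
    and f: "integrable lborel (\<lambda>y. f y * Macdonald_W (of_real (Re z)) y)"
  shows "(LBINT x:{0<..}. (LBINT y. (LBINT u. Macdonald_kernel x u y * h u) * f y) * of_real x powr (z - 1)) =
    (LBINT u. h u * Macdonald_W z u) * (LBINT y. f y * Macdonald_W z y)"
proof -
  interpret P: pair_sigma_finite "lborel \<Otimes>\<^sub>M lborel :: (real \<times> real) measure" "lborel :: real measure"
    by (simp add: pair_sigma_finite_def lborel_prod lborel.sigma_finite_measure_axioms)
  define \<Phi> where "\<Phi> p x = indicator {0<..} x *\<^sub>R (of_real x powr (z - 1) * Macdonald_kernel x (fst p) (snd p)) *
     (h (fst p) * f (snd p))" for p :: "real \<times> real" and x :: real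
  define V where "V s = Macdonald_W (of_real (Re z)) s" for s
  have [measurable]: "V \<in> borel_measurable borel" unfolding V_def[abs_def] by measurable
  have \<Phi>_meas: "case_prod \<Phi> \<in> borel_measurable ((lborel \<Otimes>\<^sub>M lborel) \<Otimes>\<^sub>M lborel)"
    unfolding \<Phi>_def by measurable
  have h0: "h u = 0 \<or> u > 0" for u using supp(1)[of u] by force
  have f0: "f y = 0 \<or> y > 0" for y using supp(2)[of y] by force
  have \<Phi>_norm: "(LBINT x. norm (\<Phi> (u, y) x)) = norm (h u * V u * (f y * V y))" for u y
  proof (cases "u > 0 \<and> y > 0")
    case True
    have "(LBINT x. norm (\<Phi> (u, y) x)) =
        (LBINT x:{0<..}. norm (of_real x powr (z - 1) * Macdonald_kernel x u y)) * norm (h u * f y)"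
    proof -
      have "norm (\<Phi> (u, y) x) = indicator {0<..} x *\<^sub>R norm (of_real x powr (z - 1) * Macdonald_kernel x u y) *
          norm (h u * f y)" for x
        by (simp add: \<Phi>_def norm_mult)
      then show ?thesis by (simp only: set_lebesgue_integral_def integral_mult_left_zero)
    qed
    also have "\<dots> = norm (h u * V u * (f y * V y))"
      using norm_Macdonald_kernel_Mellin[of u y z] True by (simp add: norm_mult V_def)
    finally show ?thesis .
  next
    case False
    then show ?thesis using h0[of u] f0[of y] by (auto simp: \<Phi>_def)
  qed
  have \<Phi>_int: "integrable lborel (\<Phi> (u, y))" for u y
  proof (cases "u > 0 \<and> y > 0")
    case True
    then have "set_integrable lborel {0<..} (\<lambda>x. of_real x powr (z - 1) * Macdonald_kernel x u y)"
      by (intro Macdonald_kernel_Mellin(1)) auto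
    then show ?thesis unfolding \<Phi>_def[abs_def] set_integrable_def fst_conv snd_conv
      by (rule integrable_mult_left)
  next
    case False
    then show ?thesis using h0[of u] f0[of y] by (auto simp: \<Phi>_def[abs_def])
  qed
  have \<Phi>: "integrable ((lborel \<Otimes>\<^sub>M lborel) \<Otimes>\<^sub>M lborel) (case_prod \<Phi>)"
  proof (rule P.Fubini_integrable[OF \<Phi>_meas])
    have "integrable (lborel \<Otimes>\<^sub>M lborel) (\<lambda>(u, y). (h u * V u) * (f y * V y))"
      using h f by (intro integrable_pair_mult(1)) (auto simp: V_def)
    then have "integrable (lborel \<Otimes>\<^sub>M lborel) (\<lambda>p. norm (case p of (u, y) \<Rightarrow> (h u * V u) * (f y * V y)))"
      by (rule integrable_norm)
    moreover have "(\<lambda>p. norm (case p of (u, y) \<Rightarrow> (h u * V u) * (f y * V y))) = (\<lambda>p. LBINT x. norm (\<Phi> p x))"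
      by (auto simp: \<Phi>_norm fun_eq_iff)
    ultimately show "integrable (lborel \<Otimes>\<^sub>M lborel) (\<lambda>p. LBINT x. norm (case (p, x) of (p, x) \<Rightarrow> \<Phi> p x))"
      by simp
    show "AE p in lborel \<Otimes>\<^sub>M lborel. integrable lborel (\<lambda>x. case (p, x) of (p, x) \<Rightarrow> \<Phi> p x)"
      using \<Phi>_int by (intro AE_I2) (auto simp: split_paired_all)
  qed
  have wint: "integrable lborel (\<lambda>u. k u * Macdonald_W z u)"
    if k: "integrable lborel (\<lambda>u. k u * V u)" and [measurable]: "k \<in> borel_measurable borel"
      and k0: "\<And>u. k u = 0 \<or> u > 0" for k
  proof (rule Bochner_Integration.integrable_bound[OF k])
    have "norm (k u * Macdonald_W z u) \<le> norm (k u * V u)" for u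
      using k0[of u]
    proof
      assume "u > 0"
      then show ?thesis
        using norm_Macdonald_W_le[of u z] by (simp add: norm_mult V_def mult_left_mono)
    qed simp
    then show "AE u in lborel. norm (k u * Macdonald_W z u) \<le> norm (k u * V u)" by simp
  qed simp
  have lhs: "integral\<^sup>L (lborel \<Otimes>\<^sub>M lborel) (\<lambda>p. \<Phi> p x) = indicator {0<..} x *\<^sub>R
      ((LBINT y. (LBINT u. Macdonald_kernel x u y * h u) * f y) * of_real x powr (z - 1))"
    if i: "integrable (lborel \<Otimes>\<^sub>M lborel) (\<lambda>p. \<Phi> p x)" for x
  proof (cases "x > 0")
    case True
    have eq: "(LBINT u. \<Phi> (u, y) x) = (LBINT u. Macdonald_kernel x u y * h u) * f y * of_real x powr (z - 1)" for y
    proof -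
      have "(LBINT u. \<Phi> (u, y) x) = (LBINT u. f y * of_real x powr (z - 1) * (Macdonald_kernel x u y * h u))"
        using True by (simp add: \<Phi>_def mult_ac)
      then show ?thesis by (simp only: integral_mult_right_zero) simp
    qed
    have split: "(\<lambda>p. \<Phi> p x) = (\<lambda>(u, y). \<Phi> (u, y) x)" by auto
    then have "integral\<^sup>L (lborel \<Otimes>\<^sub>M lborel) (\<lambda>p. \<Phi> p x) = integral\<^sup>L (lborel \<Otimes>\<^sub>M lborel) (\<lambda>(u, y). \<Phi> (u, y) x)"
      by simp
    also have "\<dots> = (LBINT y. LBINT u. \<Phi> (u, y) x)"
      using i unfolding split by (rule lborel_pair.integral_snd[symmetric])
    finally show ?thesis using True by (simp only: eq integral_mult_left_zero) simp
  qed (simp add: \<Phi>_def)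
  have "(LBINT x:{0<..}. (LBINT y. (LBINT u. Macdonald_kernel x u y * h u) * f y) * of_real x powr (z - 1)) =
    (LBINT x. integral\<^sup>L (lborel \<Otimes>\<^sub>M lborel) (\<lambda>p. \<Phi> p x))"
    unfolding set_lebesgue_integral_def
  proof (rule integral_cong_AE)
    show "(\<lambda>x. integral\<^sup>L (lborel \<Otimes>\<^sub>M lborel) (\<lambda>p. \<Phi> p x)) \<in> borel_measurable lborel"
      by (rule borel_measurable_integrable[OF P.integrable_snd[OF \<Phi>]])
    show "(\<lambda>x. indicat_real {0<..} x *\<^sub>R
      ((LBINT y. (LBINT u. Macdonald_kernel x u y * h u) * f y) * of_real x powr (z - 1))) \<in> borel_measurable lborel"
      by measurable
    show "AE x in lborel. indicat_real {0<..} x *\<^sub>R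
      ((LBINT y. (LBINT u. Macdonald_kernel x u y * h u) * f y) * of_real x powr (z - 1)) =
      integral\<^sup>L (lborel \<Otimes>\<^sub>M lborel) (\<lambda>p. \<Phi> p x)"
      using P.AE_integrable_snd[OF \<Phi>] by eventually_elim (simp only: lhs)
  qed
  also have "\<dots> = integral\<^sup>L (lborel \<Otimes>\<^sub>M lborel) (\<lambda>p. LBINT x. \<Phi> p x)"
    by (rule P.Fubini_integral[OF \<Phi>])
  also have "(\<lambda>p. LBINT x. \<Phi> p x) = (\<lambda>(u, y). (h u * Macdonald_W z u) * (f y * Macdonald_W z y))"
  proof (clarsimp simp: fun_eq_iff)
    fix u y
    show "(LBINT x. \<Phi> (u, y) x) = h u * Macdonald_W z u * (f y * Macdonald_W z y)"
    proof (cases "u > 0 \<and> y > 0")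
      case True
      have "(LBINT x. \<Phi> (u, y) x) = (LBINT x:{0<..}. of_real x powr (z - 1) * Macdonald_kernel x u y) * (h u * f y)"
        unfolding \<Phi>_def set_lebesgue_integral_def integral_mult_left_zero by simp
      then show ?thesis using Macdonald_kernel_Mellin(2)[of u y z] True by simp
    next
      case False
      then show ?thesis using h0[of u] f0[of y] by (auto simp: \<Phi>_def)
    qed
  qed
  also have "integral\<^sup>L (lborel \<Otimes>\<^sub>M lborel) \<dots> = (LBINT u. h u * Macdonald_W z u) * (LBINT y. f y * Macdonald_W z y)"
    using h f h0 f0 by (intro integrable_pair_mult(2) wint) (auto simp: V_def)
  finally show ?thesis .
qed

section \<open>The Laplace transform behind the transformation F\<close>

lemma continuous_on_lborel_integral:
  fixes k :: "'b::metric_space \<Rightarrow> real \<Rightarrow> complex"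
  assumes meas: "\<And>y. y \<in> S \<Longrightarrow> k y \<in> borel_measurable lborel"
    and cont: "\<And>t. continuous_on S (\<lambda>y. k y t)"
    and bound: "\<And>y t. y \<in> S \<Longrightarrow> norm (k y t) \<le> w t"
    and w: "integrable lborel w"
  shows "continuous_on S (\<lambda>y. LBINT t. k y t)"
proof (rule continuous_on_sequentiallyI)
  fix v a assume v: "\<forall>n. v n \<in> S" "a \<in> S" "v \<longlonglongrightarrow> a"
  show "(\<lambda>n. LBINT t. k (v n) t) \<longlonglongrightarrow> (LBINT t. k a t)"
  proof (rule integral_dominated_convergence[where w = w])
    show "AE t in lborel. (\<lambda>n. k (v n) t) \<longlonglongrightarrow> k a t"
      using v cont by (intro AE_I2 continuous_on_tendsto_compose[OF cont]) auto
  qed (use v meas bound w in auto)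
qed

lemma Gamma_integral_Laplace_real:
  assumes b: "b > (0::real)" and p: "p > 0"
  shows "set_integrable lborel {0<..} (\<lambda>x. x powr (b - 1) * exp (- p * x))"
    and "(LBINT x:{0<..}. x powr (b - 1) * exp (- p * x)) = Gamma b * p powr (- b)"
proof -
  have e: "indicator {0<..} x *\<^sub>R (complex_of_real x powr (of_real b - 1) * of_real (exp (- p * x))) =
      of_real (indicator {0<..} x *\<^sub>R (x powr (b - 1) * exp (- p * x)))" for x
  proof (cases "x > 0")
    case True
    then have "complex_of_real x powr (of_real b - 1) = of_real (x powr (b - 1))"
      by (simp flip: powr_of_real)
    then show ?thesis by (simp add: scaleR_conv_of_real)
  qed simp
  show "set_integrable lborel {0<..} (\<lambda>x. x powr (b - 1) * exp (- p * x))"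
    using Gamma_integral_Laplace(1)[of "of_real b" p] b p
    unfolding set_integrable_def e complex_of_real_integrable_eq by simp
  have "complex_of_real (LBINT x:{0<..}. x powr (b - 1) * exp (- p * x)) = Gamma (of_real b) * of_real p powr (- of_real b)"
    using Gamma_integral_Laplace(2)[of "of_real b" p] b p
    unfolding set_lebesgue_integral_def e by (simp only: integral_complex_of_real) simp
  also have "\<dots> = of_real (Gamma b * p powr (- b))"
    using p powr_of_real[of p "- b"] by (simp add: Gamma_complex_of_real)
  finally show "(LBINT x:{0<..}. x powr (b - 1) * exp (- p * x)) = Gamma b * p powr (- b)"
    by (simp only: of_real_eq_iff)
qed

text \<open>
  On the line \<open>Re s = a\<close> the factor \<open>x\<^bsup>-s\<^esup>\<close> is \<open>x\<^bsup>-a\<^esup>\<close> times an oscillation.  This gives the bound at once, and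
  continuity by dominated convergence with a majorant that does not depend on \<open>x\<close>.
\<close>

lemma inv_mellin_space_regular:
  assumes "f \<in> inv_mellin_space a"
  obtains C where "C \<ge> 0" "\<And>x. x > 0 \<Longrightarrow> norm (f x) \<le> C * x powr (- a)" "continuous_on {0<..} f"
proof -
  obtain \<phi> where \<phi>: "integrable lborel (\<lambda>t. \<phi> (Complex a t))"
    "\<And>x. x > 0 \<Longrightarrow> f x = 1 / (2 * of_real pi * \<i>) * vline_integral a (\<lambda>s. \<phi> s * of_real x powr (- s))"
    using assms unfolding inv_mellin_space_def vline_integrable_def by auto
  define k where "k x t = \<phi> (Complex a t) * exp (- (\<i> * of_real (t * ln x)))" for x t :: real
  have k_meas: "k x \<in> borel_measurable lborel" for x
    unfolding k_def using borel_measurable_integrable[OF \<phi>(1)] by simp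
  have k_norm: "norm (k x t) = norm (\<phi> (Complex a t))" for x t
    by (simp add: k_def norm_mult norm_exp_eq_Re)
  have f: "f x = 1 / (2 * of_real pi) * (of_real (x powr (- a)) * (LBINT t. k x t))" if x: "x > 0" for x
  proof -
    have "of_real x powr (- Complex a t) = of_real (x powr (- a)) * exp (- (\<i> * of_real (t * ln x)))" for t
    proof -
      have "- Complex a t * of_real (ln x) = of_real (- a * ln x) + - (\<i> * of_real (t * ln x))"
        by (simp add: complex_eq_iff)
      then show ?thesis
        unfolding of_real_powr_eq_exp[OF x] of_real_powr_real_eq_exp[OF x] by (simp only: exp_add)
    qed
    then have "vline_integral a (\<lambda>s. \<phi> s * of_real x powr (- s)) = \<i> * (LBINT t. of_real (x powr (- a)) * k x t)"
      by (simp add: vline_integral_def k_def mult_ac)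
    then show ?thesis unfolding \<phi>(2)[OF x] integral_mult_right_zero by simp
  qed
  show ?thesis
  proof
    show "1 / (2 * pi) * (LBINT t. norm (\<phi> (Complex a t))) \<ge> 0" by simp
    fix x :: real assume x: "x > 0"
    have "norm (LBINT t. k x t) \<le> (LBINT t. norm (\<phi> (Complex a t)))"
      using integral_norm_bound[of lborel "k x"] by (simp add: k_norm)
    then have "x powr (- a) * norm (LBINT t. k x t) \<le> x powr (- a) * (LBINT t. norm (\<phi> (Complex a t)))"
      by (intro mult_left_mono) auto
    then show "norm (f x) \<le> 1 / (2 * pi) * (LBINT t. norm (\<phi> (Complex a t))) * x powr (- a)"
      unfolding f[OF x] by (simp add: norm_mult norm_divide field_simps)
  next
    have "continuous_on {0<..} (\<lambda>x. LBINT t. k x t)"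
    proof (rule continuous_on_lborel_integral)
      show "continuous_on {0<..} (\<lambda>x. k x t)" for t
        unfolding k_def by (intro continuous_intros) auto
    qed (use k_meas k_norm \<phi>(1) in auto)
    then have "continuous_on {0<..} (\<lambda>x. 1 / (2 * of_real pi) * (of_real (x powr (- a)) * (LBINT t. k x t)))"
      by (intro continuous_intros) auto
    then show "continuous_on {0<..} f" using f by (subst continuous_on_cong[OF refl]) auto
  qed
qed

text \<open>
  Extension by zero from the half line, so that integrals over it can be taken over the whole line.
\<close>

definition restrict_pos :: "(real \<Rightarrow> complex) \<Rightarrow> real \<Rightarrow> complex" where
  "restrict_pos f x = indicator {0<..} x *\<^sub>R f x"

lemma restrict_pos_nonpos [simp]: "x \<le> 0 \<Longrightarrow> restrict_pos f x = 0"
  by (simp add: restrict_pos_def)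

definition Laplace :: "(real \<Rightarrow> complex) \<Rightarrow> real \<Rightarrow> complex" where
  "Laplace f p = (LBINT y:{0<..}. of_real (exp (- p * y)) * f y)"

text \<open>
  The function \<open>r \<mapsto> v\<^sup>\<gamma> e\<^bsup>-v\<^esup> L(1/v)\<close> at \<open>v = e\<^sup>r\<close>, where \<open>L\<close> is the Laplace transform of \<open>f\<close>.  Its Fourier
  transform is \<open>\<tau> \<mapsto> (Ff)(\<gamma> + i\<tau>)\<close>.
\<close>

definition log_profile :: "(real \<Rightarrow> complex) \<Rightarrow> real \<Rightarrow> real \<Rightarrow> complex" where
  "log_profile f \<gamma> r = exp (of_real (\<gamma> * r - exp r)) * Laplace f (exp (- r))"

context
  fixes f :: "real \<Rightarrow> complex" and C a :: real
  assumes f_cont: "continuous_on {0<..} f"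
    and f_le: "\<And>x. x > 0 \<Longrightarrow> norm (f x) \<le> C * x powr (- a)"
    and C: "C \<ge> 0" and a: "a < 1"
begin

lemma restrict_pos_measurable [measurable]: "restrict_pos f \<in> borel_measurable borel"
  unfolding restrict_pos_def[abs_def] by (rule borel_measurable_continuous_on_indicator) (use f_cont in auto)

lemma Laplace_alt: "Laplace f p = (LBINT y. of_real (exp (- p * y)) * restrict_pos f y)"
  unfolding Laplace_def set_lebesgue_integral_def restrict_pos_def by (simp add: mult_ac)

lemma Laplace_integrand_le:
  "norm (of_real (exp (- p * y)) * restrict_pos f y) \<le> C * (indicator {0<..} y *\<^sub>R (y powr ((1 - a) - 1) * exp (- p * y)))"
proof (cases "y > 0")
  case True
  then show ?thesis using mult_left_mono[OF f_le[OF True], of "exp (- p * y)"]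
    by (simp add: restrict_pos_def norm_mult mult_ac)
qed (simp add: restrict_pos_def)

lemma Laplace_integrable:
  assumes p: "p > 0"
  shows "integrable lborel (\<lambda>y. of_real (exp (- p * y)) * restrict_pos f y)"
proof (rule Bochner_Integration.integrable_bound)
  show "integrable lborel (\<lambda>y. C * (indicator {0<..} y *\<^sub>R (y powr ((1 - a) - 1) * exp (- p * y))))"
    using Gamma_integral_Laplace_real(1)[of "1 - a" p] a p unfolding set_integrable_def
    by (intro integrable_mult_right) simp
  show "AE y in lborel. norm (of_real (exp (- p * y)) * restrict_pos f y) \<le> norm (C * (indicator {0<..} y *\<^sub>R (y powr ((1 - a) - 1) * exp (- p * y))))"
    using Laplace_integrand_le[of p] by (intro AE_I2 order_trans[OF Laplace_integrand_le]) simp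
qed simp

lemma Laplace_norm_le:
  assumes p: "p > 0"
  shows "(LBINT y. norm (of_real (exp (- p * y)) * restrict_pos f y)) \<le> C * (Gamma (1 - a) * p powr (a - 1))"
proof -
  have "(LBINT y. norm (of_real (exp (- p * y)) * restrict_pos f y)) \<le>
      (LBINT y. C * (indicator {0<..} y *\<^sub>R (y powr ((1 - a) - 1) * exp (- p * y))))"
  proof (rule integral_mono)
    show "integrable lborel (\<lambda>y. C * (indicator {0<..} y *\<^sub>R (y powr ((1 - a) - 1) * exp (- p * y))))"
      using Gamma_integral_Laplace_real(1)[of "1 - a" p] a p unfolding set_integrable_def
      by (intro integrable_mult_right) simp
  qed (use Laplace_integrable[OF p] Laplace_integrand_le in auto)
  also have "\<dots> = C * (Gamma (1 - a) * p powr (a - 1))"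
    using Gamma_integral_Laplace_real(2)[of "1 - a" p] a p
    unfolding set_lebesgue_integral_def integral_mult_right_zero by simp
  finally show ?thesis .
qed

lemma Laplace_continuous: "continuous_on {0<..} (Laplace f)"
proof -
  have "isCont (Laplace f) p" if p: "p > 0" for p
  proof -
    have "continuous_on {p/2<..} (Laplace f)"
      unfolding Laplace_alt[abs_def]
    proof (rule continuous_on_lborel_integral)
      show "integrable lborel (\<lambda>y. norm (of_real (exp (- (p/2) * y)) * restrict_pos f y))"
        using Laplace_integrable[of "p/2"] p by simp
      show "norm (of_real (exp (- q * y)) * restrict_pos f y) \<le> norm (of_real (exp (- (p/2) * y)) * restrict_pos f y)"
        if "q \<in> {p/2<..}" for q y
      proof (cases "y > 0")
        case True
        then have "exp (- q * y) \<le> exp (- (p/2) * y)" using that by simp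
        then show ?thesis by (simp add: norm_mult mult_right_mono)
      qed (simp add: restrict_pos_def)
      show "continuous_on {p/2<..} (\<lambda>q. of_real (exp (- q * y)) * restrict_pos f y)" for y
        by (intro continuous_intros)
    qed simp
    then show ?thesis using p by (simp add: continuous_on_eq_continuous_at)
  qed
  then show ?thesis by (auto intro: continuous_at_imp_continuous_on)
qed

context
  fixes \<gamma> :: real
  assumes \<gamma>: "\<gamma> > a - 1"
begin

lemma log_profile_majorant:
  "norm (exp (z * of_real r - of_real (exp r))) * (LBINT y. norm (of_real (exp (- exp (- r) * y)) * restrict_pos f y))
    \<le> C * Gamma (1 - a) * exp ((Re z + (1 - a)) * r - exp r)"
proof -
  have "norm (exp (z * of_real r - of_real (exp r))) * (LBINT y. norm (of_real (exp (- exp (- r) * y)) * restrict_pos f y))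
    \<le> exp (Re z * r - exp r) * (C * (Gamma (1 - a) * exp (- r) powr (a - 1)))"
    using Laplace_norm_le[of "exp (- r)"] by (intro mult_mono) (auto simp: norm_exp_eq_Re)
  also have "\<dots> = C * Gamma (1 - a) * (exp (Re z * r - exp r) * exp ((1 - a) * r))"
    by (simp add: powr_def algebra_simps)
  also have "exp (Re z * r - exp r) * exp ((1 - a) * r) = exp ((Re z + (1 - a)) * r - exp r)"
    by (simp add: algebra_simps flip: exp_add)
  finally show ?thesis .
qed

lemma log_profile_majorant_integrable: "integrable lborel (\<lambda>r. C * Gamma (1 - a) * exp ((\<gamma> + (1 - a)) * r - exp r))"
proof -
  have "integrable lborel (\<lambda>r. norm (exp (of_real (\<gamma> + (1 - a)) * of_real r - of_real (1 * exp r)) :: complex))"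
    using \<gamma> by (intro integrable_norm Gamma_integral_exp(1)) auto
  then show ?thesis by (intro integrable_mult_right) (simp add: norm_exp_eq_Re)
qed

text \<open>
  Inserting the exponential integral for \<open>W\<close> and integrating first in \<open>y\<close> produces the Laplace transform of \<open>f\<close>
  at \<open>e\<^bsup>-r\<^esup>\<close>.  The bound \<open>O(p\<^bsup>a-1\<^esup>)\<close> for that transform leaves a Gamma integral of exponent \<open>\<gamma> + 1 - a > 0\<close>.
\<close>

lemma restrict_pos_Macdonald:
  assumes z: "Re z = \<gamma>"
  shows "integrable lborel (\<lambda>y. restrict_pos f y * Macdonald_W z y)"
    and "(LBINT y. restrict_pos f y * Macdonald_W z y) = (LBINT r. log_profile f \<gamma> r * iexp (Im z * r))"
proof -
  define k where "k r y = exp (z * of_real r - of_real (exp r)) * (of_real (exp (- exp (- r) * y)) * restrict_pos f y)" for r y :: real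
  have k_meas [measurable]: "case_prod k \<in> borel_measurable (lborel \<Otimes>\<^sub>M lborel)"
    unfolding k_def by measurable
  have ki: "integrable (lborel \<Otimes>\<^sub>M lborel) (case_prod k)"
  proof (rule lborel_pair.Fubini_integrable)
    show "AE r in lborel. integrable lborel (\<lambda>y. case_prod k (r, y))"
      unfolding k_def using Laplace_integrable by (intro AE_I2) simp
    show "integrable lborel (\<lambda>r. LBINT y. norm (case_prod k (r, y)))"
    proof (rule Bochner_Integration.integrable_bound[OF log_profile_majorant_integrable])
      show "(\<lambda>r. LBINT y. norm (case_prod k (r, y))) \<in> borel_measurable lborel" by measurable
      have "norm (LBINT y. norm (case_prod k (r, y))) \<le> norm (C * Gamma (1 - a) * exp ((\<gamma> + (1 - a)) * r - exp r))" for r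
      proof -
        have "norm (LBINT y. norm (case_prod k (r, y))) = 
          norm (exp (z * of_real r - of_real (exp r))) * (LBINT y. norm (of_real (exp (- exp (- r) * y)) * restrict_pos f y))"
          unfolding case_prod_conv k_def norm_mult[of "exp (z * _ - _)"] integral_mult_right_zero by simp
        also have "\<dots> \<le> C * Gamma (1 - a) * exp ((\<gamma> + (1 - a)) * r - exp r)"
          using log_profile_majorant[of z r] z by simp
        also have "\<dots> \<le> norm \<dots>" by simp
        finally show ?thesis .
      qed
      then show "AE r in lborel. norm (LBINT y. norm (case_prod k (r, y))) \<le> norm (C * Gamma (1 - a) * exp ((\<gamma> + (1 - a)) * r - exp r))"
        by simp
    qed
  qed simp
  have inner: "(LBINT r. k r y) = restrict_pos f y * Macdonald_W z y" for y
  proof -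
    have "exp (z * of_real r - of_real (exp r)) * of_real (exp (- exp (- r) * y)) =
        exp (z * of_real r - of_real (exp r + y * exp (- r)))" for r
      unfolding exp_of_real[of "- exp (- r) * y", symmetric] exp_add[symmetric]
      by (rule arg_cong[of _ _ exp]) (simp add: algebra_simps)
    then have "k r y = restrict_pos f y * exp (z * of_real r - of_real (exp r + y * exp (- r)))" for r
      unfolding k_def by (metis mult.assoc mult.commute)
    then show ?thesis by (simp add: Macdonald_W_def)
  qed
  show "integrable lborel (\<lambda>y. restrict_pos f y * Macdonald_W z y)"
    using lborel_pair.integrable_snd[OF ki] by (simp only: inner)
  have "(LBINT y. restrict_pos f y * Macdonald_W z y) = (LBINT r. LBINT y. k r y)"
    using lborel_pair.Fubini_integral[OF ki] by (simp only: inner)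
  also have "\<dots> = (LBINT r. log_profile f \<gamma> r * iexp (Im z * r))"
  proof (intro Bochner_Integration.integral_cong refl)
    fix r
    have "exp (z * of_real r - of_real (exp r)) = exp (of_real (\<gamma> * r - exp r)) * iexp (Im z * r)"
      unfolding exp_add[symmetric] using z by (intro arg_cong[of _ _ exp]) (simp add: complex_eq_iff)
    then show "(LBINT y. k r y) = log_profile f \<gamma> r * iexp (Im z * r)"
      unfolding k_def integral_mult_right_zero Laplace_alt[symmetric] log_profile_def by simp
  qed
  finally show "(LBINT y. restrict_pos f y * Macdonald_W z y) = (LBINT r. log_profile f \<gamma> r * iexp (Im z * r))" .
qed

lemma log_profile_le: "norm (log_profile f \<gamma> r) \<le> C * Gamma (1 - a) * exp ((\<gamma> + (1 - a)) * r - exp r)"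
proof -
  have "norm (Laplace f (exp (- r))) \<le> (LBINT y. norm (of_real (exp (- exp (- r) * y)) * restrict_pos f y))"
    unfolding Laplace_alt by (rule integral_norm_bound)
  then have "norm (log_profile f \<gamma> r) \<le> norm (exp (of_real \<gamma> * of_real r - of_real (exp r)) :: complex) * 
      (LBINT y. norm (of_real (exp (- exp (- r) * y)) * restrict_pos f y))"
    unfolding log_profile_def norm_mult by (intro mult_mono) (auto simp: norm_exp_eq_Re)
  also have "\<dots> \<le> C * Gamma (1 - a) * exp ((\<gamma> + (1 - a)) * r - exp r)"
    using log_profile_majorant[of "of_real \<gamma>" r] by simp
  finally show ?thesis .
qed

lemma log_profile_continuous: "continuous_on UNIV (log_profile f \<gamma>)"
  unfolding log_profile_def[abs_def]
  by (intro continuous_intros continuous_on_compose2[OF Laplace_continuous]) auto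

lemma log_profile_integrable: "integrable lborel (log_profile f \<gamma>)"
proof (rule Bochner_Integration.integrable_bound[OF log_profile_majorant_integrable])
  show "log_profile f \<gamma> \<in> borel_measurable lborel"
    using borel_measurable_continuous_onI[OF log_profile_continuous] by simp
  show "AE r in lborel. norm (log_profile f \<gamma> r) \<le> norm (C * Gamma (1 - a) * exp ((\<gamma> + (1 - a)) * r - exp r))"
    using log_profile_le by (intro AE_I2 order_trans[OF log_profile_le]) simp
qed

lemma log_profile_bounded: "\<exists>B. \<forall>r. norm (log_profile f \<gamma> r) \<le> B"
proof -
  define b where "b = \<gamma> + (1 - a)"
  obtain n :: nat where n: "b < n" using reals_Archimedean2 by blast
  have b: "b > 0" using \<gamma> by (simp add: b_def)
  have "exp (b * r - exp r) \<le> fact n" for r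
  proof (cases "r \<le> 0")
    case True
    then have "b * r \<le> 0" using b by (simp add: mult_nonneg_nonpos)
    then have "exp (b * r - exp r) \<le> exp 0" unfolding exp_le_cancel_iff by (smt (verit) exp_gt_zero)
    also have "\<dots> \<le> fact n" by simp
    finally show ?thesis .
  next
    case False
    have "exp (b * r - exp r) = exp (b * r) * exp (- exp r)" by (simp flip: exp_add)
    also have "\<dots> \<le> exp (n * r) * (fact n / exp r ^ n)"
      using False n by (intro mult_mono exp_minus_le_fact_over_power) auto
    also have "\<dots> = fact n" by (simp add: exp_of_nat_mult)
    finally show ?thesis .
  qed
  moreover have "C * Gamma (1 - a) \<ge> 0" using C a Gamma_real_pos[of "1 - a"] by simp
  ultimately have "norm (log_profile f \<gamma> r) \<le> C * Gamma (1 - a) * fact n" for r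
    using log_profile_le[of r] unfolding b_def by (meson mult_left_mono order_trans)
  then show ?thesis by blast
qed

text \<open>
  Fourier inversion of the profile at \<open>r = - ln p\<close>.
\<close>

theorem Laplace_inversion:
  assumes F: "integrable lborel (\<lambda>\<tau>. LBINT y. restrict_pos f y * Macdonald_W (Complex \<gamma> \<tau>) y)" and p: "p > 0"
  shows "Laplace f p = 1 / (2 * of_real pi) * (LBINT \<tau>. (LBINT y. restrict_pos f y * Macdonald_W (Complex \<gamma> \<tau>) y) *
     (of_real (exp (1 / p)) * of_real p powr Complex \<gamma> \<tau>))"
proof -
  define U where "U \<tau> = (LBINT y. restrict_pos f y * Macdonald_W (Complex \<gamma> \<tau>) y)" for \<tau>
  have U: "U \<tau> = (LBINT r. log_profile f \<gamma> r * iexp (\<tau> * r))" for \<tau>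
    unfolding U_def using restrict_pos_Macdonald(2)[of "Complex \<gamma> \<tau>"] by simp
  obtain B where B: "\<And>r. norm (log_profile f \<gamma> r) \<le> B" using log_profile_bounded by blast
  define r where "r = - ln p"
  have r: "exp (- r) = p" "exp r = 1 / p" using p by (simp_all add: r_def exp_minus inverse_eq_divide)
  have "log_profile f \<gamma> r = 1 / (2 * of_real pi) * (LBINT \<tau>. U \<tau> * iexp (- (\<tau> * r)))"
    unfolding U using F unfolding U_def[symmetric] U
    by (intro Fourier_inversion[OF log_profile_continuous B log_profile_integrable]) 
  moreover have "log_profile f \<gamma> r = of_real (exp (- (1 / p)) * p powr (- \<gamma>)) * Laplace f p"
  proof -
    have "exp (\<gamma> * r - 1 / p) = exp (- (1 / p)) * p powr (- \<gamma>)"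
      using p by (simp add: powr_def r_def flip: exp_add)
    then show ?thesis unfolding log_profile_def r exp_of_real by simp
  qed
  ultimately have "Laplace f p = of_real (exp (1 / p) * p powr \<gamma>) * (1 / (2 * of_real pi) * (LBINT \<tau>. U \<tau> * iexp (- (\<tau> * r))))"
    using p by (simp add: exp_minus powr_minus field_simps)
  also have "\<dots> = 1 / (2 * of_real pi) * (LBINT \<tau>. of_real (exp (1 / p) * p powr \<gamma>) * (U \<tau> * iexp (- (\<tau> * r))))"
    unfolding integral_mult_right_zero by simp
  also have "(\<lambda>\<tau>. of_real (exp (1 / p) * p powr \<gamma>) * (U \<tau> * iexp (- (\<tau> * r)))) =
     (\<lambda>\<tau>. U \<tau> * (of_real (exp (1 / p)) * of_real p powr Complex \<gamma> \<tau>))"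
  proof
    fix \<tau>
    have "Complex \<gamma> \<tau> * of_real (ln p) = of_real (\<gamma> * ln p) + \<i> * of_real (- (\<tau> * r))"
      by (simp add: complex_eq_iff r_def)
    then have "of_real p powr Complex \<gamma> \<tau> = of_real (p powr \<gamma>) * iexp (- (\<tau> * r))"
      unfolding of_real_powr_eq_exp[OF p] of_real_powr_real_eq_exp[OF p] by (simp only: exp_add)
    then show "of_real (exp (1 / p) * p powr \<gamma>) * (U \<tau> * iexp (- (\<tau> * r))) =
      U \<tau> * (of_real (exp (1 / p)) * of_real p powr Complex \<gamma> \<tau>)" by simp
  qed
  finally show ?thesis by (simp only: U_def)
qed

end
end

section \<open>The Bessel kernel of the inversion formula\<close>

text \<open>
  The function \<open>x\<^bsup>-(1+z)/2\<^esup> I\<^bsub>-(1+z)\<^esub>(2\<surd>x)\<close>, with the powers of \<open>x\<close> collected in each term of the series.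
\<close>

definition Bessel_kernel :: "complex \<Rightarrow> real \<Rightarrow> complex" where
  "Bessel_kernel z x = (\<Sum>k. of_real x powr (of_nat k - 1 - z) * (rGamma (of_nat k - z) / fact k))"

lemma Gamma_mult_rGamma_real:
  assumes "x > (0::real)"
  shows "Gamma x * rGamma x = 1"
  using Gamma_real_pos[OF assms] by (simp add: rGamma_inverse_Gamma)

text \<open>
  The quotient \<open>\<Gamma>(s) / \<Gamma>(s + k)\<close> is the reciprocal of a product of factors \<open>s + j\<close>, each at least as large as
  its real part.  The dependence on \<open>Im s\<close> is therefore carried by the single value \<open>1/\<Gamma>(s)\<close>.
\<close>

lemma norm_rGamma_shift_le:
  assumes "Re s > 0"
  shows "norm (rGamma (s + of_nat k)) \<le> norm (rGamma s) * (Gamma (Re s) * rGamma (Re s + k))"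
proof -
  have pos: "pochhammer (Re s) k > 0" using assms by (rule pochhammer_pos)
  have "pochhammer (Re s) k \<le> norm (pochhammer s k)"
    using assms unfolding pochhammer_prod prod_norm[symmetric]
    by (intro prod_mono) (auto intro!: order_trans[OF _ complex_Re_le_cmod])
  moreover have "rGamma s = rGamma (s + of_nat k) * pochhammer s k"
    using pochhammer_rGamma[of s k] assms by (auto simp: mult.commute)
  ultimately have "norm (rGamma (s + of_nat k)) * pochhammer (Re s) k \<le> norm (rGamma s)"
    by (simp add: norm_mult mult_left_mono)
  moreover have "rGamma (Re s) = rGamma (Re s + k) * pochhammer (Re s) k"
    using pochhammer_rGamma[of "Re s" k] assms by (auto simp: mult.commute)
  moreover have "Gamma (Re s) * rGamma (Re s) = 1"
    using assms by (rule Gamma_mult_rGamma_real)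
  ultimately have "Gamma (Re s) * rGamma (Re s + k) = 1 / pochhammer (Re s) k"
    and "norm (rGamma (s + of_nat k)) \<le> norm (rGamma s) / pochhammer (Re s) k"
    using pos by (simp_all add: eq_divide_eq pos_le_divide_eq mult.assoc)
  then show ?thesis by simp
qed

lemma Gamma_mult_rGamma_shift_le:
  assumes a: "a > (0::real)"
  shows "Gamma a * rGamma (a + real k) \<le> 1 / min 1 a"
proof -
  have "pochhammer a k \<ge> min 1 a"
  proof (cases k)
    case (Suc m)
    have "1 \<le> pochhammer (a + 1) m"
      unfolding pochhammer_prod using a by (intro prod_ge_1) auto
    then have "a * 1 \<le> a * pochhammer (a + 1) m" using a by (intro mult_left_mono) auto
    then show ?thesis by (simp add: Suc pochhammer_rec)
  qed simp
  moreover have "rGamma a = rGamma (a + k) * pochhammer a k"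
    using pochhammer_rGamma[of a k] a by (auto simp: mult.commute)
  moreover have "Gamma a * rGamma a = 1" by (rule Gamma_mult_rGamma_real[OF a])
  ultimately have "Gamma a * rGamma (a + real k) * pochhammer a k = 1" 
    and "min 1 a \<le> pochhammer a k" by (simp_all add: mult.assoc)
  moreover have "Gamma a * rGamma (a + real k) \<ge> 0"
    using Gamma_real_pos[of a] Gamma_real_pos[of "a + k"] a by (simp add: rGamma_inverse_Gamma)
  ultimately have "Gamma a * rGamma (a + real k) * min 1 a \<le> 1"
    by (metis mult_left_mono)
  then show ?thesis using a by (simp add: pos_le_divide_eq)
qed

lemma borel_measurable_Bessel_kernel [measurable (raw)]:
  assumes [measurable]: "Z \<in> borel_measurable M" "X \<in> borel_measurable M"
  shows "(\<lambda>w. Bessel_kernel (Z w) (X w)) \<in> borel_measurable M"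
proof -
  have [measurable]: "rGamma \<in> borel_measurable (borel :: complex measure)"
    by (intro borel_measurable_continuous_onI continuous_on_rGamma)
  show ?thesis unfolding Bessel_kernel_def by measurable
qed

context
  fixes z :: complex
  assumes z: "Re z < 0"
begin

lemma norm_rGamma_of_nat_diff_le:
  "norm (rGamma (of_nat k - z)) \<le> norm (rGamma (- z)) * (1 / min 1 (- Re z))"
proof -
  have "norm (rGamma (of_nat k - z)) \<le> norm (rGamma (- z)) * (Gamma (Re (- z)) * rGamma (Re (- z) + k))"
    using norm_rGamma_shift_le[of "- z" k] z by (simp add: add.commute)
  also have "\<dots> \<le> norm (rGamma (- z)) * (1 / min 1 (- Re z))"
    using Gamma_mult_rGamma_shift_le[of "- Re z" k] z by (intro mult_left_mono) auto
  finally show ?thesis .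
qed

lemma Bessel_kernel_term_le:
  assumes x: "x > 0"
  shows "norm (of_real x powr (of_nat k - 1 - z) * (rGamma (of_nat k - z) / fact k))
    \<le> norm (rGamma (- z)) * (x powr (- Re z - 1) / min 1 (- Re z)) * (x ^ k / fact k)"
proof -
  have 2: "norm (of_real x powr (of_nat k - 1 - z)) = x powr (- Re z - 1) * x ^ k"
  proof -
    have "norm (of_real x powr (of_nat k - 1 - z)) = x powr ((- Re z - 1) + real k)"
      using x by (simp add: norm_powr_real_powr algebra_simps)
    then show ?thesis using x by (simp add: powr_add powr_realpow)
  qed
  have "norm (of_real x powr (of_nat k - 1 - z) * (rGamma (of_nat k - z) / fact k)) =
     norm (rGamma (of_nat k - z)) * ((x powr (- Re z - 1) * x ^ k) / fact k)"
    by (simp add: norm_mult norm_divide 2)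
  also have "\<dots> \<le> norm (rGamma (- z)) * (1 / min 1 (- Re z)) * ((x powr (- Re z - 1) * x ^ k) / fact k)"
    using x by (intro mult_right_mono norm_rGamma_of_nat_diff_le) auto
  finally show ?thesis by (simp add: mult_ac)
qed

lemma Bessel_kernel_summable:
  assumes x: "x > 0"
  shows "summable (\<lambda>k. norm (of_real x powr (of_nat k - 1 - z) * (rGamma (of_nat k - z) / fact k)))"
proof (rule summable_comparison_test)
  show "\<exists>N. \<forall>k\<ge>N. norm (norm (of_real x powr (of_nat k - 1 - z) * (rGamma (of_nat k - z) / fact k)))
    \<le> norm (rGamma (- z)) * (x powr (- Re z - 1) / min 1 (- Re z)) * (x ^ k / fact k)"
    using Bessel_kernel_term_le[OF x] by (intro exI[of _ 0]) simp
  show "summable (\<lambda>k. norm (rGamma (- z)) * (x powr (- Re z - 1) / min 1 (- Re z)) * (x ^ k / fact k))"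
    using summable_exp[of x] by (intro summable_mult) (simp add: divide_inverse mult.commute)
qed

text \<open>
  The point of this bound is that it separates: \<open>Im z\<close> enters only through \<open>1/\<Gamma>(-z)\<close>.  The growth \<open>e\<^sup>x\<close> is
  far from optimal, but every exponential bound serves in a Laplace transform with large \<open>p\<close>.
\<close>

lemma norm_Bessel_kernel_le:
  assumes x: "x > 0"
  shows "norm (Bessel_kernel z x) \<le> norm (rGamma (- z)) * (x powr (- Re z - 1) / min 1 (- Re z) * exp x)"
proof -
  let ?t = "\<lambda>k. of_real x powr (of_nat k - 1 - z) * (rGamma (of_nat k - z) / fact k)"
  let ?C = "norm (rGamma (- z)) * (x powr (- Re z - 1) / min 1 (- Re z))"
  have s: "summable (\<lambda>k. x ^ k / fact k)"
    using summable_exp[of x] by (simp add: divide_inverse mult.commute)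
  have "norm (Bessel_kernel z x) \<le> (\<Sum>k. norm (?t k))"
    unfolding Bessel_kernel_def by (rule summable_norm[OF Bessel_kernel_summable[OF x]])
  also have "\<dots> \<le> (\<Sum>k. ?C * (x ^ k / fact k))"
    by (intro suminf_le Bessel_kernel_term_le[OF x] Bessel_kernel_summable[OF x] summable_mult s)
  also have "\<dots> = ?C * exp x"
    using suminf_mult[OF s, of ?C] by (simp add: exp_def divide_inverse mult.commute)
  finally show ?thesis by (simp add: mult.assoc)
qed

text \<open>
  A power of \<open>x\<close> times an everywhere convergent power series.
\<close>

lemma continuous_on_Bessel_kernel: "continuous_on {0<..} (Bessel_kernel z)"
proof -
  define c where "c k = rGamma (of_nat k - z) / fact k" for k
  have "summable (\<lambda>k. c k * y ^ k)" for y
  proof (rule summable_comparison_test)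
    show "summable (\<lambda>k. norm (rGamma (- z)) * (1 / min 1 (- Re z)) * (norm y ^ k / fact k))"
      using summable_exp[of "norm y"] by (intro summable_mult) (simp add: divide_inverse mult.commute)
    have "norm (c k * y ^ k) \<le> norm (rGamma (- z)) * (1 / min 1 (- Re z)) * (norm y ^ k / fact k)" for k
    proof -
      have "norm (c k * y ^ k) = norm (rGamma (of_nat k - z)) * (norm y ^ k / fact k)"
        by (simp add: c_def norm_mult norm_divide norm_power)
      also have "\<dots> \<le> norm (rGamma (- z)) * (1 / min 1 (- Re z)) * (norm y ^ k / fact k)"
        by (intro mult_right_mono norm_rGamma_of_nat_diff_le) simp
      finally show ?thesis .
    qed
    then show "\<exists>N. \<forall>k\<ge>N. norm (c k * y ^ k) \<le> norm (rGamma (- z)) * (1 / min 1 (- Re z)) * (norm y ^ k / fact k)"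
      by blast
  qed
  then have "continuous_on UNIV (\<lambda>y. \<Sum>k. c k * y ^ k)"
    by (intro continuous_at_imp_continuous_on ballI isCont_powser_converges_everywhere)
  then have "continuous_on {0<..} (\<lambda>x::real. \<Sum>k. c k * of_real x ^ k)"
    by (rule continuous_on_compose2) (auto intro: continuous_intros)
  then have "continuous_on {0<..} (\<lambda>x. exp ((- 1 - z) * of_real (ln x)) * (\<Sum>k. c k * of_real x ^ k))"
    by (rule continuous_on_mult[rotated]) (auto intro!: continuous_intros)
  then show ?thesis
  proof (rule continuous_on_eq)
    fix x :: real assume "x \<in> {0<..}"
    then have x: "x > 0" by simp
    have t: "of_real x powr (of_nat k - 1 - z) * (rGamma (of_nat k - z) / fact k) =
       of_real x powr (- 1 - z) * (c k * of_real x ^ k)" for k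
    proof -
      have "complex_of_real x powr (of_nat k - 1 - z) = of_real x powr ((- 1 - z) + of_nat k)"
        by (simp add: algebra_simps)
      also have "\<dots> = of_real x powr (- 1 - z) * of_real x ^ k"
        using x by (simp only: powr_add powr_nat) simp
      finally show ?thesis by (simp add: c_def)
    qed
    have "summable (\<lambda>k. of_real x powr (- 1 - z) * (c k * of_real x ^ k))"
      unfolding t[symmetric] by (rule summable_norm_cancel[OF Bessel_kernel_summable[OF x]])
    moreover have "complex_of_real x powr (- 1 - z) \<noteq> 0" using x by simp
    ultimately have "summable (\<lambda>k. c k * of_real x ^ k)"
      by (simp only: summable_cmult_iff simp_thms)
    then show "exp ((- 1 - z) * of_real (ln x)) * (\<Sum>k. c k * of_real x ^ k) = Bessel_kernel z x"
      unfolding Bessel_kernel_def t of_real_powr_eq_exp[OF x, symmetric] by (rule suminf_mult[symmetric])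
  qed
qed

lemma bessel_I_eq_Bessel_kernel:
  assumes x: "x > 0"
  shows "bessel_I (- (1 + z)) (2 * sqrt x) * of_real x powr (- (1 + z) / 2) = Bessel_kernel z x"
proof -
  let ?t = "\<lambda>k. of_real (2 * sqrt x / 2) powr (- (1 + z) + 2 * of_nat k) * rGamma (- (1 + z) + of_nat k + 1) / fact k"
  let ?P = "complex_of_real x powr (- (1 + z) / 2)"
  have ln: "ln (sqrt x) = ln x / 2" using x by (simp add: ln_sqrt)
  have eq: "?t k * ?P = of_real x powr (of_nat k - 1 - z) * (rGamma (of_nat k - z) / fact k)" for k
  proof -
    have "of_real (2 * sqrt x / 2) powr (- (1 + z) + 2 * of_nat k) * ?P = of_real x powr (of_nat k - 1 - z)"
      using x by (simp add: powr_def Ln_of_real ln flip: exp_add)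
         (rule arg_cong[of _ _ exp], simp add: field_simps)
    moreover have "- (1 + z) + of_nat k + 1 = of_nat k - z" by simp
    moreover have "(A * R / F) * P = (A * P) * (R / F)" for A R F P :: complex by simp
    ultimately show ?thesis by (simp only:)
  qed
  have "summable (\<lambda>k. ?P * ?t k)"
    unfolding mult.commute[of ?P] eq by (rule summable_norm_cancel[OF Bessel_kernel_summable[OF x]])
  moreover have "?P \<noteq> 0" using x by simp
  ultimately have "summable ?t" by (simp only: summable_cmult_iff) simp
  then show ?thesis
    unfolding bessel_I_def Bessel_kernel_def by (subst suminf_mult2) (simp_all only: eq)
qed

text \<open>
  The term \<open>x\<^bsup>k-1-z\<^esup> / (k! \<Gamma>(k-z))\<close> has the Laplace transform \<open>p\<^bsup>z-k\<^esup> / k!\<close>.  For \<open>k = 0\<close> its integral converges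
  at \<open>0\<close> because \<open>Re z < 0\<close>.
\<close>

lemma Bessel_kernel_Laplace:
  assumes p: "p > 0"
  shows "(LBINT x:{0<..}. of_real (exp (- p * x)) * Bessel_kernel z x) = of_real (exp (1 / p)) * of_real p powr z"
proof -
  define T where "T k x = indicator {0<..} x *\<^sub>R (of_real (exp (- p * x)) *
    (of_real x powr (of_nat k - 1 - z) * (rGamma (of_nat k - z) / fact k)))" for k :: nat and x
  have T: "T k x = (rGamma (of_nat k - z) / fact k) *
      (indicator {0<..} x *\<^sub>R (of_real x powr ((of_nat k - z) - 1) * of_real (exp (- p * x))))" for k x
  proof -
    have "of_nat k - z - 1 = of_nat k - 1 - z" by simp
    then show ?thesis by (simp only: T_def mult_scaleR_right mult_ac)
  qed
  have Re: "Re (of_nat k - z) > 0" for k using z by simp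
  have G: "Gamma (of_nat k - z) * rGamma (of_nat k - z) = 1" for k
  proof -
    have "rGamma (of_nat k - z) \<noteq> 0"
    proof
      assume "rGamma (of_nat k - z) = 0"
      then obtain n where "of_nat k - z = of_int n" "n \<le> 0"
        unfolding rGamma_eq_zero_iff by (elim nonpos_Ints_cases)
      then show False using Re[of k] by simp
    qed
    then show ?thesis by (simp add: Gamma_def)
  qed
  have Ti: "integrable lborel (T k)" for k
    unfolding T[abs_def] using Gamma_integral_Laplace(1)[OF Re p] unfolding set_integrable_def
    by (intro integrable_mult_right)
  have Tint: "integral\<^sup>L lborel (T k) = of_real p powr z * (of_real ((1 / p) ^ k) / fact k)" for k
  proof -
    have "integral\<^sup>L lborel (T k) = (rGamma (of_nat k - z) / fact k) * (Gamma (of_nat k - z) * of_real p powr (- (of_nat k - z)))"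
      using Gamma_integral_Laplace(2)[OF Re p, of k]
      unfolding T[abs_def] integral_mult_right_zero set_lebesgue_integral_def by simp
    also have "\<dots> = of_real p powr (z - of_nat k) / fact k"
      using G[of k] by (simp add: mult_ac)
    also have "of_real p powr (z - of_nat k) = of_real p powr z * of_real ((1 / p) ^ k)"
      using p by (simp add: powr_diff powr_nat power_one_over divide_inverse power_inverse)
    finally show ?thesis by simp
  qed
  have Tnorm: "(LBINT x. norm (T k x)) \<le> norm (rGamma (- z)) * Gamma (- Re z) * p powr (Re z) * ((1 / p) ^ k / fact k)" for k
  proof -
    have "(LBINT x. norm (T k x)) = Re (complex_of_real (LBINT x. norm (T k x)))" by simp
    also have "complex_of_real (LBINT x. norm (T k x)) = (LBINT x. of_real (norm (T k x)))"
      by simp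
    also have "\<dots> = (LBINT x. of_real (norm (rGamma (of_nat k - z) / fact k)) *
      (indicator {0<..} x *\<^sub>R (of_real x powr (of_real (k - Re z) - 1) * of_real (exp (- p * x)))))"
    proof (intro Bochner_Integration.integral_cong refl)
      fix x :: real
      show "complex_of_real (norm (T k x)) = of_real (norm (rGamma (of_nat k - z) / fact k)) *
        (indicator {0<..} x *\<^sub>R (of_real x powr (of_real (k - Re z) - 1) * of_real (exp (- p * x))))"
      proof (cases "x > 0")
        case True
        then have pw: "complex_of_real x powr (of_real (k - Re z) - 1) = of_real (x powr (k - Re z - 1))"
          by (simp flip: powr_of_real)
        have "norm (complex_of_real x powr (of_nat k - z - 1)) = x powr (k - Re z - 1)"
          using True by (simp add: norm_powr_real_powr)
        then have nT: "norm (T k x) = norm (rGamma (of_nat k - z) / fact k) *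
            (x powr (k - Re z - 1) * exp (- p * x))"
          unfolding T norm_mult norm_scaleR using True by simp
        show ?thesis unfolding nT pw using True by simp
      qed (simp add: T)
    qed
    also have "\<dots> = of_real (norm (rGamma (of_nat k - z) / fact k)) * (Gamma (of_real (k - Re z)) * of_real p powr (- of_real (k - Re z)))"
      using Gamma_integral_Laplace(2)[of "of_real (k - Re z)" p] z p
      unfolding integral_mult_right_zero set_lebesgue_integral_def by simp
    also have "\<dots> = of_real (norm (rGamma (of_nat k - z)) / fact k * (Gamma (k - Re z) * p powr (- (k - Re z))))"
    proof -
      have "complex_of_real p powr (- of_real (k - Re z)) = of_real (p powr (- (k - Re z)))"
        using powr_of_real[of p "- (k - Re z)"] p by (simp only: of_real_minus)
      moreover have "norm (rGamma (of_nat k - z) / fact k) = norm (rGamma (of_nat k - z)) / fact k"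
        by (simp add: norm_divide)
      ultimately show ?thesis by (simp only: Gamma_complex_of_real of_real_mult)
    qed
    also have "Re \<dots> = norm (rGamma (of_nat k - z)) / fact k * (Gamma (k - Re z) * p powr (- (k - Re z)))"
      by (rule Re_complex_of_real)
    also have "\<dots> \<le> norm (rGamma (- z)) * (Gamma (- Re z) * rGamma (- Re z + k)) / fact k * (Gamma (k - Re z) * p powr (- (k - Re z)))"
      using norm_rGamma_shift_le[of "- z" k] z
      by (intro mult_right_mono divide_right_mono) (auto simp: add.commute intro!: mult_nonneg_nonneg Gamma_real_nonneg)
    also have "\<dots> = norm (rGamma (- z)) * Gamma (- Re z) * p powr (Re z) * ((1 / p) ^ k / fact k)"
    proof -
      have "rGamma (- Re z + k) * Gamma (k - Re z) = 1"
        using z Gamma_mult_rGamma_real[of "k - Re z"] by (simp add: mult.commute)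
      moreover have "p powr (- (k - Re z)) = p powr (Re z) * (1 / p) ^ k"
        using p by (simp add: powr_diff powr_realpow power_divide)
      moreover have "N * (G * R) / F * (G' * (P * Q)) = N * G * (R * G') * P * (Q / F)" for N G R F G' P Q :: real
        by simp
      ultimately show ?thesis by (simp only: mult_1_right)
    qed
    finally show ?thesis .
  qed
  have es: "summable (\<lambda>k. (1 / p) ^ k / fact k)" "(\<Sum>k. (1 / p) ^ k / fact k) = exp (1 / p)"
    using summable_exp[of "1 / p"] by (simp_all add: exp_def divide_inverse mult.commute)
  have Tsum: "AE x in lborel. summable (\<lambda>k. norm (T k x))"
  proof (rule AE_I2)
    fix x :: real
    show "summable (\<lambda>k. norm (T k x))"
    proof (cases "x > 0")
      case True
      then have "norm (T k x) = exp (- p * x) *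
          norm (of_real x powr (of_nat k - 1 - z) * (rGamma (of_nat k - z) / fact k))" for k
        unfolding T_def by (simp only: norm_mult norm_scaleR norm_of_real) simp
      then show ?thesis using summable_mult[OF Bessel_kernel_summable[OF True], of "exp (- p * x)"]
        by (simp only:)
    qed (simp add: T_def)
  qed
  have Nsum: "summable (\<lambda>k. LBINT x. norm (T k x))"
  proof (rule summable_comparison_test)
    show "\<exists>N. \<forall>k\<ge>N. norm (LBINT x. norm (T k x)) \<le> norm (rGamma (- z)) * Gamma (- Re z) * p powr (Re z) * ((1 / p) ^ k / fact k)"
      using Tnorm by (intro exI[of _ 0]) simp
  qed (intro summable_mult es)
  have "(LBINT x:{0<..}. of_real (exp (- p * x)) * Bessel_kernel z x) = (LBINT x. \<Sum>k. T k x)"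
    unfolding set_lebesgue_integral_def
  proof (intro Bochner_Integration.integral_cong refl)
    fix x :: real
    show "indicat_real {0<..} x *\<^sub>R (of_real (exp (- p * x)) * Bessel_kernel z x) = (\<Sum>k. T k x)"
    proof (cases "x > 0")
      case True
      then show ?thesis unfolding T_def Bessel_kernel_def
        using suminf_mult[OF summable_norm_cancel[OF Bessel_kernel_summable[OF True]], of "of_real (exp (- p * x))"]
        by simp
    qed (simp add: T_def)
  qed
  also have "\<dots> = (\<Sum>k. integral\<^sup>L lborel (T k))"
    by (rule integral_suminf[OF Ti Tsum Nsum])
  also have "\<dots> = of_real p powr z * (\<Sum>k. of_real ((1 / p) ^ k / fact k))"
    unfolding Tint using summable_of_real[OF es(1), where 'a = complex] by (subst suminf_mult[symmetric]) simp_all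
  also have "(\<Sum>k. complex_of_real ((1 / p) ^ k / fact k)) = of_real (exp (1 / p))"
    using suminf_of_real[OF es(1), where 'a = complex] es(2) by simp
  finally show ?thesis by (simp only: mult.commute)
qed

end

section \<open>Inversion of the transformation F\<close>

lemma norm_Gamma_le:
  assumes "Re s > 0"
  shows "norm (Gamma s) \<le> Gamma (Re s)"
proof -
  have "norm (Gamma s) = norm (LBINT r. exp (s * of_real r - of_real (1 * exp r)))"
    using Gamma_integral_exp(2)[of s 1] assms by simp
  also have "\<dots> \<le> (LBINT r. norm (exp (s * of_real r - of_real (1 * exp r))))"
    by (rule integral_norm_bound)
  also have "\<dots> = Re (LBINT r. exp (of_real (Re s) * of_real r - of_real (1 * exp r)))"
  proof -
    have "exp (of_real (Re s) * of_real r - of_real (1 * exp r)) =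
        complex_of_real (norm (exp (s * of_real r - of_real (1 * exp r))))" for r
      by (simp add: norm_exp_eq_Re flip: exp_of_real)
    then show ?thesis by (simp only: integral_complex_of_real Re_complex_of_real)
  qed
  also have "\<dots> = Gamma (Re s)"
    using Gamma_integral_exp(2)[of "of_real (Re s)" 1] assms by (simp add: Gamma_complex_of_real)
  finally show ?thesis .
qed

text \<open>
  For \<open>|\<tau>| > 1\<close> the weight majorises \<open>1/\<Gamma>(-\<gamma> - i\<tau>)\<close>, and for \<open>|\<tau>| \<le> 1\<close> both factors are bounded.  Conversely
  \<open>|\<Gamma>(-\<gamma> - i\<tau>)| \<le> \<Gamma>(-\<gamma>)\<close>, so that integrability with this factor implies integrability without it.
\<close>

lemma integrable_of_rGamma_weight:
  fixes U :: "real \<Rightarrow> complex"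
  assumes \<gamma>: "\<gamma> < 0" and U_meas [measurable]: "U \<in> borel_measurable borel"
    and U_bdd: "\<And>\<tau>. norm (U \<tau>) \<le> M"
    and U_int: "set_integrable lborel {\<tau>. \<bar>\<tau>\<bar> > 1} (\<lambda>\<tau>. norm (U \<tau>) * (\<bar>\<tau>\<bar> powr (\<gamma> + 1/2) * exp (pi * \<bar>\<tau>\<bar> / 2)))"
  shows "integrable lborel (\<lambda>\<tau>. rGamma (- Complex \<gamma> \<tau>) * U \<tau>)" and "integrable lborel U"
proof -
  have cont: "continuous_on UNIV (\<lambda>\<tau>. rGamma (- Complex \<gamma> \<tau>))"
    by (intro continuous_on_compose2[OF continuous_on_rGamma[of UNIV]]) (auto simp: Complex_eq intro!: continuous_intros)
  then have [measurable]: "(\<lambda>\<tau>. rGamma (- Complex \<gamma> \<tau>)) \<in> borel_measurable borel"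
    by (rule borel_measurable_continuous_onI)
  obtain C where C: "C > 0" "\<And>\<tau>. \<bar>\<tau>\<bar> \<ge> 1 \<Longrightarrow>
      norm (rGamma (Complex (- \<gamma>) \<tau>)) \<le> C * (\<bar>\<tau>\<bar> powr (1/2 - - \<gamma>) * exp (pi * \<bar>\<tau>\<bar> / 2))"
    using norm_rGamma_vertical_le[of "- \<gamma>"] \<gamma> by auto
  have "compact ((\<lambda>\<tau>. rGamma (- Complex \<gamma> \<tau>)) ` {-1..1})"
    using cont by (intro compact_continuous_image continuous_on_subset[OF cont]) auto
  then have "bounded ((\<lambda>\<tau>. rGamma (- Complex \<gamma> \<tau>)) ` {-1..1})"
    by (rule compact_imp_bounded)
  then obtain K where K: "\<And>\<tau>. \<tau> \<in> {-1..1} \<Longrightarrow> norm (rGamma (- Complex \<gamma> \<tau>)) \<le> K"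
    unfolding bounded_iff by (metis imageI)
  define W where "W \<tau> = norm (U \<tau>) * (\<bar>\<tau>\<bar> powr (\<gamma> + 1/2) * exp (pi * \<bar>\<tau>\<bar> / 2))" for \<tau>
  define w where "w \<tau> = C * (indicator {\<tau>. \<bar>\<tau>\<bar> > 1} \<tau> *\<^sub>R W \<tau>) + indicator {-1..1} \<tau> *\<^sub>R (K * M)" for \<tau>
  have w: "integrable lborel w"
    unfolding w_def using U_int unfolding set_integrable_def W_def[symmetric]
    by (intro Bochner_Integration.integrable_add integrable_mult_right integrable_real_indicator) auto
  have le: "norm (rGamma (- Complex \<gamma> \<tau>) * U \<tau>) \<le> w \<tau>" for \<tau>
  proof (cases "\<bar>\<tau>\<bar> > 1")
    case True
    have "- Complex \<gamma> \<tau> = Complex (- \<gamma>) (- \<tau>)" by (simp add: complex_eq_iff)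
    then have "norm (rGamma (- Complex \<gamma> \<tau>)) \<le> C * (\<bar>\<tau>\<bar> powr (\<gamma> + 1/2) * exp (pi * \<bar>\<tau>\<bar> / 2))"
      using C(2)[of "- \<tau>"] True by (simp add: add.commute)
    then have "norm (rGamma (- Complex \<gamma> \<tau>)) * norm (U \<tau>) \<le> C * (\<bar>\<tau>\<bar> powr (\<gamma> + 1/2) * exp (pi * \<bar>\<tau>\<bar> / 2)) * norm (U \<tau>)"
      by (rule mult_right_mono) simp
    moreover have "\<tau> \<notin> {-1..1}" using True by auto
    ultimately show ?thesis using True by (simp add: w_def W_def norm_mult mult_ac)
  next
    case False
    then have "\<tau> \<in> {-1..1}" by auto
    then have "norm (rGamma (- Complex \<gamma> \<tau>)) * norm (U \<tau>) \<le> K * M"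
      using K[of \<tau>] U_bdd[of \<tau>] by (intro mult_mono) (auto intro: order_trans[OF norm_ge_zero])
    then show ?thesis using False \<open>\<tau> \<in> {-1..1}\<close> by (simp add: w_def norm_mult)
  qed
  show i: "integrable lborel (\<lambda>\<tau>. rGamma (- Complex \<gamma> \<tau>) * U \<tau>)"
    by (rule Bochner_Integration.integrable_bound[OF w])
       (use le in \<open>auto intro!: AE_I2 intro: order_trans[OF le]\<close>)
  show "integrable lborel U"
  proof (rule Bochner_Integration.integrable_bound[OF integrable_mult_right[OF i, of "of_real (Gamma (- \<gamma>))"]])
    have "norm (U \<tau>) \<le> norm (of_real (Gamma (- \<gamma>)) * (rGamma (- Complex \<gamma> \<tau>) * U \<tau>))" for \<tau>
    proof -
      have Re: "Re (- Complex \<gamma> \<tau>) > 0" using \<gamma> by simp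
      have "rGamma (- Complex \<gamma> \<tau>) \<noteq> 0"
      proof
        assume "rGamma (- Complex \<gamma> \<tau>) = 0"
        then obtain n where "- Complex \<gamma> \<tau> = of_int n" "n \<le> 0"
          unfolding rGamma_eq_zero_iff by (elim nonpos_Ints_cases)
        then show False using Re by simp
      qed
      then have "1 = norm (Gamma (- Complex \<gamma> \<tau>)) * norm (rGamma (- Complex \<gamma> \<tau>))"
        by (simp add: Gamma_def flip: norm_mult)
      also have "\<dots> \<le> Gamma (- \<gamma>) * norm (rGamma (- Complex \<gamma> \<tau>))"
        using norm_Gamma_le[OF Re] by (intro mult_right_mono) auto
      finally have "1 * norm (U \<tau>) \<le> Gamma (- \<gamma>) * norm (rGamma (- Complex \<gamma> \<tau>)) * norm (U \<tau>)"
        by (intro mult_right_mono) auto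
      then show ?thesis using Gamma_real_pos[of "- \<gamma>"] \<gamma> by (simp add: norm_mult mult.assoc)
    qed
    then show "AE \<tau> in lborel. norm (U \<tau>) \<le> norm (of_real (Gamma (- \<gamma>)) * (rGamma (- Complex \<gamma> \<tau>) * U \<tau>))"
      by simp
  qed simp
qed

context
  fixes \<gamma> :: real and U :: "real \<Rightarrow> complex"
  assumes \<gamma>: "\<gamma> < 0" and U_meas [measurable]: "U \<in> borel_measurable borel"
    and U_int: "integrable lborel (\<lambda>\<tau>. rGamma (- Complex \<gamma> \<tau>) * U \<tau>)"
begin

lemma measurable_Complex_line [measurable]: "Complex \<gamma> \<in> borel_measurable borel"
  unfolding Complex_eq[abs_def] by measurable

definition "Bessel_majorant x = x powr (- \<gamma> - 1) / min 1 (- \<gamma>) * exp x"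

lemma Bessel_synthesis_integrand_le:
  assumes "x > 0"
  shows "norm (Bessel_kernel (Complex \<gamma> \<tau>) x * U \<tau>) \<le> Bessel_majorant x * norm (rGamma (- Complex \<gamma> \<tau>) * U \<tau>)"
  using mult_right_mono[OF norm_Bessel_kernel_le[of "Complex \<gamma> \<tau>" x], of "norm (U \<tau>)"] \<gamma> assms
  by (simp add: norm_mult mult_ac Bessel_majorant_def)

lemma Bessel_synthesis_integrable:
  assumes "x > 0"
  shows "integrable lborel (\<lambda>\<tau>. Bessel_kernel (Complex \<gamma> \<tau>) x * U \<tau>)"
proof (rule Bochner_Integration.integrable_bound)
  show "integrable lborel (\<lambda>\<tau>. Bessel_majorant x * norm (rGamma (- Complex \<gamma> \<tau>) * U \<tau>))"
    using U_int by simp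
  show "AE \<tau> in lborel. norm (Bessel_kernel (Complex \<gamma> \<tau>) x * U \<tau>) \<le> norm (Bessel_majorant x * norm (rGamma (- Complex \<gamma> \<tau>) * U \<tau>))"
    using Bessel_synthesis_integrand_le[OF assms] by (intro AE_I2) (rule order_trans, assumption, simp)
qed measurable

lemma Bessel_majorant_pos: "x > 0 \<Longrightarrow> Bessel_majorant x > 0"
  using \<gamma> by (simp add: Bessel_majorant_def)

text \<open>
  Divided by the majorant in \<open>x\<close>, the integrand is dominated independently of \<open>x\<close>.
\<close>

lemma Bessel_synthesis_continuous:
  "continuous_on {0<..} (\<lambda>x. LBINT \<tau>. Bessel_kernel (Complex \<gamma> \<tau>) x * U \<tau>)"
proof -
  have b: "continuous_on {0<..} Bessel_majorant"
    unfolding Bessel_majorant_def[abs_def] using \<gamma> by (intro continuous_intros) auto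
  have "continuous_on {0<..} (\<lambda>x. LBINT \<tau>. Bessel_kernel (Complex \<gamma> \<tau>) x * U \<tau> / of_real (Bessel_majorant x))"
  proof (rule continuous_on_lborel_integral[where w = "\<lambda>\<tau>. norm (rGamma (- Complex \<gamma> \<tau>) * U \<tau>)"])
    show "continuous_on {0<..} (\<lambda>x. Bessel_kernel (Complex \<gamma> \<tau>) x * U \<tau> / of_real (Bessel_majorant x))" for \<tau>
      using \<gamma> Bessel_majorant_pos
      by (intro continuous_on_divide continuous_on_mult continuous_on_const continuous_on_of_real b continuous_on_Bessel_kernel)
         fastforce+
    show "norm (Bessel_kernel (Complex \<gamma> \<tau>) x * U \<tau> / of_real (Bessel_majorant x)) \<le> norm (rGamma (- Complex \<gamma> \<tau>) * U \<tau>)"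
      if "x \<in> {0<..}" for x \<tau>
      using that Bessel_synthesis_integrand_le[of x \<tau>] Bessel_majorant_pos[of x]
      by (simp add: norm_divide pos_divide_le_eq mult.commute del: norm_mult)
    show "(\<lambda>\<tau>. Bessel_kernel (Complex \<gamma> \<tau>) x * U \<tau> / of_real (Bessel_majorant x)) \<in> borel_measurable lborel" for x
      by measurable
  qed (use U_int in simp)
  then have "continuous_on {0<..} (\<lambda>x. of_real (Bessel_majorant x) * (LBINT \<tau>. Bessel_kernel (Complex \<gamma> \<tau>) x * U \<tau> / of_real (Bessel_majorant x)))"
    by (intro continuous_intros b)
  then show ?thesis
  proof (rule continuous_on_eq)
    fix x :: real assume "x \<in> {0<..}"
    then have "of_real (Bessel_majorant x) \<noteq> (0::complex)" using Bessel_majorant_pos[of x] by simp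
    then show "of_real (Bessel_majorant x) * (LBINT \<tau>. Bessel_kernel (Complex \<gamma> \<tau>) x * U \<tau> / of_real (Bessel_majorant x)) =
       (LBINT \<tau>. Bessel_kernel (Complex \<gamma> \<tau>) x * U \<tau>)"
      unfolding integral_divide_zero by simp
  qed
qed

lemma Bessel_synthesis_Laplace:
  assumes p: "p > 1"
  shows "set_integrable lborel {0<..} (\<lambda>x. of_real (exp (- p * x)) * (LBINT \<tau>. Bessel_kernel (Complex \<gamma> \<tau>) x * U \<tau>))"
    and "(LBINT x:{0<..}. of_real (exp (- p * x)) * (LBINT \<tau>. Bessel_kernel (Complex \<gamma> \<tau>) x * U \<tau>)) =
      (LBINT \<tau>. U \<tau> * (of_real (exp (1 / p)) * of_real p powr Complex \<gamma> \<tau>))"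
proof -
  define k where "k x \<tau> = indicator {0<..} x *\<^sub>R (of_real (exp (- p * x)) * (Bessel_kernel (Complex \<gamma> \<tau>) x * U \<tau>))" for x \<tau>
  have [measurable]: "case_prod k \<in> borel_measurable (lborel \<Otimes>\<^sub>M lborel)"
    unfolding k_def by measurable
  define d where "d x = complex_of_real (indicator {0<..} x *\<^sub>R (exp (- p * x) * Bessel_majorant x))" for x
  have "integrable lborel (\<lambda>x. indicator {0<..} x *\<^sub>R (exp (- p * x) * Bessel_majorant x))"
  proof -
    have "set_integrable lborel {0<..} (\<lambda>x. x powr (- \<gamma> - 1) * exp (- (p - 1) * x))"
      using \<gamma> p by (intro Gamma_integral_Laplace_real(1)) auto
    then have "integrable lborel (\<lambda>x. (indicator {0<..} x *\<^sub>R (x powr (- \<gamma> - 1) * exp (- (p - 1) * x))) * (1 / min 1 (- \<gamma>)))"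
      unfolding set_integrable_def by (rule integrable_mult_left)
    moreover have "exp (- (p - 1) * x) = exp (- p * x) * exp x" for x
      by (simp add: algebra_simps flip: exp_add)
    ultimately show ?thesis by (simp add: Bessel_majorant_def mult_ac)
  qed
  then have d: "integrable lborel d" unfolding d_def complex_of_real_integrable_eq .
  have ki: "integrable (lborel \<Otimes>\<^sub>M lborel) (case_prod k)"
  proof (rule Bochner_Integration.integrable_bound)
    show "integrable (lborel \<Otimes>\<^sub>M lborel) (\<lambda>(x, \<tau>). d x * (rGamma (- Complex \<gamma> \<tau>) * U \<tau>))"
      by (rule integrable_pair_mult(1)[OF d U_int])
    have "norm (k x \<tau>) \<le> norm (d x * (rGamma (- Complex \<gamma> \<tau>) * U \<tau>))" for x \<tau>
    proof (cases "x > 0")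
      case True
      have "norm (k x \<tau>) = exp (- p * x) * norm (Bessel_kernel (Complex \<gamma> \<tau>) x * U \<tau>)"
        using True by (simp add: k_def norm_mult)
      also have "\<dots> \<le> exp (- p * x) * (Bessel_majorant x * norm (rGamma (- Complex \<gamma> \<tau>) * U \<tau>))"
        by (intro mult_left_mono Bessel_synthesis_integrand_le True) simp
      also have "\<dots> = norm (d x * (rGamma (- Complex \<gamma> \<tau>) * U \<tau>))"
        using True Bessel_majorant_pos[OF True] by (simp add: d_def norm_mult)
      finally show ?thesis .
    qed (simp add: k_def)
    then show "AE q in lborel \<Otimes>\<^sub>M lborel. norm (case_prod k q) \<le> norm (case q of (x, \<tau>) \<Rightarrow> d x * (rGamma (- Complex \<gamma> \<tau>) * U \<tau>))"
      by (intro AE_I2) (auto simp: split_paired_all)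
  qed simp
  have k1: "(LBINT \<tau>. k x \<tau>) = indicator {0<..} x *\<^sub>R (of_real (exp (- p * x)) * (LBINT \<tau>. Bessel_kernel (Complex \<gamma> \<tau>) x * U \<tau>))" for x
    unfolding k_def by simp
  have k2: "(LBINT x. k x \<tau>) = U \<tau> * (of_real (exp (1 / p)) * of_real p powr Complex \<gamma> \<tau>)" for \<tau>
  proof -
    have "(LBINT x. k x \<tau>) = U \<tau> * (LBINT x:{0<..}. of_real (exp (- p * x)) * Bessel_kernel (Complex \<gamma> \<tau>) x)"
      unfolding set_lebesgue_integral_def integral_mult_right_zero[symmetric] k_def by (simp add: mult_ac)
    then show ?thesis using Bessel_kernel_Laplace[of "Complex \<gamma> \<tau>" p] \<gamma> p by simp
  qed
  show "set_integrable lborel {0<..} (\<lambda>x. of_real (exp (- p * x)) * (LBINT \<tau>. Bessel_kernel (Complex \<gamma> \<tau>) x * U \<tau>))"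
    using lborel_pair.integrable_fst[OF ki] unfolding set_integrable_def k1 .
  show "(LBINT x:{0<..}. of_real (exp (- p * x)) * (LBINT \<tau>. Bessel_kernel (Complex \<gamma> \<tau>) x * U \<tau>)) =
      (LBINT \<tau>. U \<tau> * (of_real (exp (1 / p)) * of_real p powr Complex \<gamma> \<tau>))"
    using lborel_pair.Fubini_integral[OF ki] unfolding set_lebesgue_integral_def k1 k2 by simp
qed

end

text \<open>
  Both sides of the second conclusion are continuous on the half line and have the same Laplace transform for
  \<open>p > 1\<close>: Laplace inversion on the left, the transform of the Bessel kernel under the integral on the
  right.
\<close>

theorem Macdonald_inversion:
  fixes f :: "real \<Rightarrow> complex"
  assumes f: "f \<in> inv_mellin_space c0" and c0: "c0 < 1" and \<gamma>: "\<gamma> > c0 - 1" "\<gamma> < 0"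
  defines "U \<equiv> \<lambda>\<tau>. LBINT y. restrict_pos f y * Macdonald_W (Complex \<gamma> \<tau>) y"
  assumes U: "set_integrable lborel {\<tau>. \<bar>\<tau>\<bar> > 1} (\<lambda>\<tau>. norm (U \<tau>) * (\<bar>\<tau>\<bar> powr (\<gamma> + 1/2) * exp (pi * \<bar>\<tau>\<bar> / 2)))"
    and x: "x > 0"
  shows "integrable lborel (\<lambda>\<tau>. Bessel_kernel (Complex \<gamma> \<tau>) x * U \<tau>)"
    and "f x = 1 / (2 * of_real pi) * (LBINT \<tau>. Bessel_kernel (Complex \<gamma> \<tau>) x * U \<tau>)"
proof -
  obtain C where C: "C \<ge> 0" "\<And>x. x > 0 \<Longrightarrow> norm (f x) \<le> C * x powr (- c0)" "continuous_on {0<..} f"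
    using inv_mellin_space_regular[OF f] by blast
  note fa = C(3,2,1) c0
  have U_Fourier: "U \<tau> = (LBINT r. log_profile f \<gamma> r * iexp (\<tau> * r))" for \<tau>
    unfolding U_def using restrict_pos_Macdonald(2)[OF fa \<gamma>(1), of "Complex \<gamma> \<tau>"] by simp
  have lp [measurable]: "log_profile f \<gamma> \<in> borel_measurable borel"
    using borel_measurable_integrable[OF log_profile_integrable[OF fa \<gamma>(1)]] by simp
  have U_meas: "U \<in> borel_measurable borel"
    unfolding U_Fourier[abs_def] by measurable
  have U_bdd: "norm (U \<tau>) \<le> (LBINT r. norm (log_profile f \<gamma> r))" for \<tau>
    unfolding U_Fourier using integral_norm_bound[of lborel "\<lambda>r. log_profile f \<gamma> r * iexp (\<tau> * r)"]
    by (simp add: norm_mult)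
  note W = integrable_of_rGamma_weight[OF \<gamma>(2) U_meas U_bdd U]
  show "integrable lborel (\<lambda>\<tau>. Bessel_kernel (Complex \<gamma> \<tau>) x * U \<tau>)"
    by (rule Bessel_synthesis_integrable[OF \<gamma>(2) U_meas W(1) x])
  define g where "g x = 1 / (2 * of_real pi) * (LBINT \<tau>. Bessel_kernel (Complex \<gamma> \<tau>) x * U \<tau>)" for x
  have f_int: "set_integrable lborel {0<..} (\<lambda>x. of_real (exp (- p * x)) * f x)" if "p > 0" for p
    using Laplace_integrable[OF fa that] unfolding set_integrable_def restrict_pos_def by (simp add: mult_ac)
  have g_int: "set_integrable lborel {0<..} (\<lambda>x. of_real (exp (- p * x)) * g x)"
   and g_Laplace: "(LBINT x:{0<..}. of_real (exp (- p * x)) * g x) = Laplace f p" if p: "p > 1" for p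
  proof -
    note S = Bessel_synthesis_Laplace[OF \<gamma>(2) U_meas W(1) p]
    have e: "of_real (exp (- p * x)) * g x = 1 / (2 * of_real pi) *
        (of_real (exp (- p * x)) * (LBINT \<tau>. Bessel_kernel (Complex \<gamma> \<tau>) x * U \<tau>))" for x
      by (simp add: g_def)
    show "set_integrable lborel {0<..} (\<lambda>x. of_real (exp (- p * x)) * g x)"
      unfolding e using S(1) by (intro set_integrable_mult_right) simp
    have "Laplace f p = 1 / (2 * of_real pi) * (LBINT \<tau>. U \<tau> * (of_real (exp (1 / p)) * of_real p powr Complex \<gamma> \<tau>))"
      unfolding U_def using W(2) p by (intro Laplace_inversion[OF fa \<gamma>(1)]) (auto simp: U_def)
    then show "(LBINT x:{0<..}. of_real (exp (- p * x)) * g x) = Laplace f p"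
      unfolding e set_integral_mult_right S(2) by simp
  qed
  have "(\<lambda>x. f x - g x) x = 0"
  proof (rule Laplace_uniqueness[where \<sigma> = 2, OF _ _ _ x])
    have "continuous_on {0<..} g"
      unfolding g_def by (intro continuous_intros Bessel_synthesis_continuous[OF \<gamma>(2) U_meas W(1)])
    then show "continuous_on {0<..} (\<lambda>x. f x - g x)" by (intro continuous_intros C(3))
    show "set_integrable lborel {0<..} (\<lambda>x. of_real (exp (- 2 * x)) * (f x - g x))"
      unfolding right_diff_distrib by (intro set_integral_diff(1) f_int g_int) auto
    show "(LBINT x:{0<..}. of_real (exp (- (2 + real n) * x)) * (f x - g x)) = 0" for n
    proof -
      have "(LBINT x:{0<..}. of_real (exp (- (2 + real n) * x)) * (f x - g x)) =
          (LBINT x:{0<..}. of_real (exp (- (2 + real n) * x)) * f x) - (LBINT x:{0<..}. of_real (exp (- (2 + real n) * x)) * g x)"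
        unfolding right_diff_distrib by (intro set_integral_diff(2) f_int g_int) auto
      also have "\<dots> = 0" using g_Laplace[of "2 + real n"] by (simp add: Laplace_def)
      finally show ?thesis .
    qed
  qed
  then show "f x = 1 / (2 * of_real pi) * (LBINT \<tau>. Bessel_kernel (Complex \<gamma> \<tau>) x * U \<tau>)"
    by (simp add: g_def)
qed

lemma F_transform_eq:
  "F_transform h z = (LBINT x. restrict_pos h x * Macdonald_W z x)"
proof -
  have "restrict_pos h x * Macdonald_W z x =
      2 * (indicator {0<..} x *\<^sub>R (of_real x powr (z / 2) * bessel_K z (2 * sqrt x) * h x))" for x
    by (cases "x > 0") (simp_all add: restrict_pos_def Macdonald_W_eq_bessel_K)
  then show ?thesis
    unfolding F_transform_def set_lebesgue_integral_def by (simp only: integral_mult_right_zero)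
qed

lemma conv_kernel_eq:
  "conv_kernel h x y = (LBINT u. Macdonald_kernel x u y * restrict_pos h u)"
proof -
  have "Macdonald_kernel x u y * restrict_pos h u =
      2 * (indicator {0<..} u *\<^sub>R (bessel_K 0 (2 * sqrt ((x + y) * (x + u) / x)) * h u))" for u
    by (simp add: Macdonald_kernel_def restrict_pos_def)
  then show ?thesis
    unfolding conv_kernel_def set_lebesgue_integral_def by (simp only: integral_mult_right_zero)
qed

theorem theorem9:
  fixes c0 \<alpha> :: real and f g h :: "real \<Rightarrow> complex"
  assumes "c0 < 1" and "0 > \<alpha>" and "\<alpha> > c0 - 1"
    and "f \<in> inv_mellin_space c0"
    and "h \<in> weighted_L1 {0<..}
               (\<lambda>x. 2 * x powr (\<alpha> / 2) * Re (bessel_K (of_real \<alpha>) (2 * sqrt x)))"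
    and "g \<in> weighted_L1 {0<..} (\<lambda>x. x powr (\<alpha> - 1))"
    and "\<And>z. Re z \<in> {\<alpha><..<0} \<Longrightarrow> F_transform h z \<noteq> 0"
    and "\<And>\<gamma>. \<gamma> \<in> {\<alpha><..<0} \<Longrightarrow>
           (\<lambda>\<tau>. mellin g (Complex \<gamma> \<tau>) / F_transform h (Complex \<gamma> \<tau>))
             \<in> weighted_L1 {\<tau>. \<bar>\<tau>\<bar> > 1} (\<lambda>\<tau>. \<bar>\<tau>\<bar> powr (\<gamma> + 1 / 2) * exp (pi * \<bar>\<tau>\<bar> / 2))"
    and "\<And>x. x > 0 \<Longrightarrow> (LBINT y:{0<..}. conv_kernel h x y * f y) = g x"
  shows "\<forall>\<gamma>\<in>{\<alpha><..<0}. \<forall>x>0.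
           vline_integrable \<gamma> (\<lambda>z. bessel_I (- (1 + z)) (2 * sqrt x)
               * of_real x powr (- (1 + z) / 2) * (mellin g z / F_transform h z)) \<and>
           f x = 1 / (2 * of_real pi * \<i>) *
             vline_integral \<gamma> (\<lambda>z. bessel_I (- (1 + z)) (2 * sqrt x)
               * of_real x powr (- (1 + z) / 2) * (mellin g z / F_transform h z))"
proof (intro ballI allI impI)
  fix \<gamma> x :: real assume "\<gamma> \<in> {\<alpha><..<0}" and x: "x > 0"
  then have \<gamma>: "\<alpha> < \<gamma>" "\<gamma> < 0" "c0 - 1 < \<gamma>" using assms(3) by auto
  obtain C where C: "C \<ge> 0" "\<And>x. x > 0 \<Longrightarrow> norm (f x) \<le> C * x powr (- c0)" "continuous_on {0<..} f"
    using inv_mellin_space_regular[OF assms(4)] by blast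
  note fa = C(3,2,1) assms(1)
  have h_meas: "restrict_pos h \<in> borel_measurable borel"
    using assms(5) by (simp add: weighted_L1_def set_borel_measurable_def restrict_pos_def[abs_def])
  \<comment> \<open>A divergent integral has the value \<open>0\<close>, so the absence of zeros of \<open>Fh\<close> in the strip supplies the convergence
      of its integral on the line \<open>Re z = \<gamma>\<close>.\<close>
  have h_int: "integrable lborel (\<lambda>x. restrict_pos h x * Macdonald_W z x)" if "Re z = \<gamma>" for z
    using assms(7)[of z] that \<gamma> not_integrable_integral_eq unfolding F_transform_eq by fastforce
  define U where "U \<tau> = (LBINT y. restrict_pos f y * Macdonald_W (Complex \<gamma> \<tau>) y)" for \<tau>
  have quot: "mellin g (Complex \<gamma> \<tau>) / F_transform h (Complex \<gamma> \<tau>) = U \<tau>" for \<tau>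
  proof -
    let ?z = "Complex \<gamma> \<tau>"
    have "mellin g ?z = (LBINT x:{0<..}. (LBINT y. (LBINT u. Macdonald_kernel x u y * restrict_pos h u) * restrict_pos f y) * of_real x powr (?z - 1))"
      unfolding mellin_def
    proof (intro set_lebesgue_integral_cong allI impI)
      fix x :: real assume "x \<in> {0<..}"
      then have "g x = (LBINT y:{0<..}. conv_kernel h x y * f y)" using assms(9) by simp
      then have "g x = (LBINT y. (LBINT u. Macdonald_kernel x u y * restrict_pos h u) * restrict_pos f y)"
        by (simp add: conv_kernel_eq set_lebesgue_integral_def restrict_pos_def[of f])
      then show "g x * of_real x powr (?z - 1) =
          (LBINT y. (LBINT u. Macdonald_kernel x u y * restrict_pos h u) * restrict_pos f y) * of_real x powr (?z - 1)"
        by simp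
    qed simp
    also have "\<dots> = F_transform h ?z * U \<tau>"
      unfolding F_transform_eq U_def
    proof (rule Mellin_Macdonald_convolution[OF h_meas])
      show "integrable lborel (\<lambda>u. restrict_pos h u * Macdonald_W (of_real (Re ?z)) u)"
        unfolding complex.sel by (intro h_int Re_complex_of_real)
      show "integrable lborel (\<lambda>y. restrict_pos f y * Macdonald_W (of_real (Re ?z)) y)"
        unfolding complex.sel by (intro restrict_pos_Macdonald(1)[OF fa \<gamma>(3)] Re_complex_of_real)
    qed (simp_all add: restrict_pos_measurable[OF fa])
    finally show ?thesis using assms(7)[of ?z] \<gamma> by simp
  qed
  have U_int: "set_integrable lborel {\<tau>. \<bar>\<tau>\<bar> > 1} (\<lambda>\<tau>. norm (U \<tau>) * (\<bar>\<tau>\<bar> powr (\<gamma> + 1/2) * exp (pi * \<bar>\<tau>\<bar> / 2)))"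
    using assms(8)[of \<gamma>] \<gamma> unfolding quot weighted_L1_def by simp
  note inversion = Macdonald_inversion[OF assms(4) assms(1) \<gamma>(3,2) U_int[unfolded U_def] x, folded U_def]
  have ker: "bessel_I (- (1 + Complex \<gamma> \<tau>)) (2 * sqrt x) * of_real x powr (- (1 + Complex \<gamma> \<tau>) / 2) = Bessel_kernel (Complex \<gamma> \<tau>) x" for \<tau>
    using \<gamma> by (intro bessel_I_eq_Bessel_kernel x) simp
  show "vline_integrable \<gamma> (\<lambda>z. bessel_I (- (1 + z)) (2 * sqrt x)
               * of_real x powr (- (1 + z) / 2) * (mellin g z / F_transform h z)) \<and>
           f x = 1 / (2 * of_real pi * \<i>) *
             vline_integral \<gamma> (\<lambda>z. bessel_I (- (1 + z)) (2 * sqrt x)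
               * of_real x powr (- (1 + z) / 2) * (mellin g z / F_transform h z))"
    unfolding vline_integrable_def vline_integral_def ker quot using inversion by simp
qed

end
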